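(* Let $\mathbb{CH}^n$ be the complex hyperbolic space of complex dimension $n$ with holomorphic sectional curvature $-4$, let $x_0\in\mathbb{CH}^n$ and $r(\cdot)=\mathrm{dist}_{\mathbb{CH}^n}(\cdot,x_0)$. Then $\mathbb{CH}^n$ satisfies a weighted Poincaré inequality with the weight function $$q=n^2+\frac14 r^{-2}+(n-1)^2(\sinh r)^{-2}-(\sinh(2r))^{-2},$$ that is, $$\int_{\mathbb{CH}^n} q\,\phi^2\le\int_{\mathbb{CH}^n}|\nabla\phi|^2$$ for all smooth functions $\phi$ on $\mathbb{CH}^n$ with compact support.
   Context: A complete Riemannian manifold $X$ is said to satisfy a weighted Poincaré inequality with a weight function $q\in L^1_{loc}(X)$ if $\int_X q\phi^2\le\int_X|\nabla\phi|^2$ for all smooth functions $\phi$ on $X$ with compact support. Integrals are with respect to the Riemannian measure. *)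

theory Defs
  imports "HOL-Analysis.Analysis"
begin

text \<open>Riemannian metrics are given in a single global chart: \<open>X\<close> is an open set of a Euclidean
  space and \<open>g z v w\<close> is the metric at \<open>z\<close> on the tangent vectors \<open>v\<close>, \<open>w\<close>.\<close>

text \<open>The Riemannian distance is the infimum of lengths of piecewise \<open>C\<^sup>1\<close> curves. The library's
  \<^const>\<open>valid_path\<close> only asks for \<open>C\<^sup>1\<close> off a finite set of parameters, where the speed may blow up;
  writing the length with \<open>has_integral\<close> admits only curves of finite length (a bare \<open>integral\<close>
  would assign the length \<open>0\<close> to the others).\<close>

definition curve_length_is ::
    "('a::euclidean_space \<Rightarrow> 'a \<Rightarrow> 'a \<Rightarrow> real) \<Rightarrow> (real \<Rightarrow> 'a) \<Rightarrow> real \<Rightarrow> bool" where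
  "curve_length_is g \<gamma> L \<longleftrightarrow>
     ((\<lambda>t. sqrt (g (\<gamma> t) (vector_derivative \<gamma> (at t)) (vector_derivative \<gamma> (at t))))
        has_integral L) {0..1}"

definition riem_dist ::
    "'a::euclidean_space set \<Rightarrow> ('a \<Rightarrow> 'a \<Rightarrow> 'a \<Rightarrow> real) \<Rightarrow> 'a \<Rightarrow> 'a \<Rightarrow> real" where
  "riem_dist X g x y =
     Inf {L. \<exists>\<gamma>. valid_path \<gamma> \<and> path_image \<gamma> \<subseteq> X \<and> pathstart \<gamma> = x \<and> pathfinish \<gamma> = y
               \<and> curve_length_is g \<gamma> L}"

definition riem_grad ::
    "('a::euclidean_space \<Rightarrow> 'a \<Rightarrow> 'a \<Rightarrow> real) \<Rightarrow> ('a \<Rightarrow> real) \<Rightarrow> 'a \<Rightarrow> 'a" where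
  "riem_grad g f z = (THE w. \<forall>v. g z w v = frechet_derivative f (at z) v)"

text \<open>The real coordinate frame \<open>\<partial>/\<partial>x\<^sub>i\<close> (left summand), \<open>\<partial>/\<partial>y\<^sub>i\<close> (right summand) of
  complex \<open>n\<close>-space, orthonormal for the Euclidean structure. Its Gram matrix yields the usual
  Riemannian measure \<open>sqrt (det g) dx dy\<close>.\<close>

definition coord_frame :: "'n + 'n \<Rightarrow> complex ^ 'n::finite" where
  "coord_frame k = (case k of Inl i \<Rightarrow> axis i 1 | Inr i \<Rightarrow> axis i \<i>)"

definition gram_matrix ::
    "(complex ^ 'n::finite \<Rightarrow> complex ^ 'n \<Rightarrow> complex ^ 'n \<Rightarrow> real) \<Rightarrow> complex ^ 'n
       \<Rightarrow> real ^ ('n + 'n) ^ ('n + 'n)" where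
  "gram_matrix g z = (\<chi> j k. g z (coord_frame j) (coord_frame k))"

definition riem_measure ::
    "(complex ^ 'n::finite) set \<Rightarrow> (complex ^ 'n \<Rightarrow> complex ^ 'n \<Rightarrow> complex ^ 'n \<Rightarrow> real)
       \<Rightarrow> (complex ^ 'n) measure" where
  "riem_measure X g =
     density (restrict_space lborel X) (\<lambda>z. ennreal (sqrt (det (gram_matrix g z))))"

text \<open>On an open set, a function is \<open>C\<^sup>k\<close> iff all iterated directional derivatives of order at
  most \<open>k\<close> exist and are continuous.\<close>

primrec Ck_on :: "nat \<Rightarrow> 'a::euclidean_space set \<Rightarrow> ('a \<Rightarrow> real) \<Rightarrow> bool" where
  "Ck_on 0 X f \<longleftrightarrow> continuous_on X f"
| "Ck_on (Suc k) X f \<longleftrightarrow>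
     (\<forall>x\<in>X. f differentiable (at x)) \<and> (\<forall>v. Ck_on k X (\<lambda>x. frechet_derivative f (at x) v))"

definition smooth_on :: "'a::euclidean_space set \<Rightarrow> ('a \<Rightarrow> real) \<Rightarrow> bool" where
  "smooth_on X f \<longleftrightarrow> (\<forall>k. Ck_on k X f)"

text \<open>The support is the closure relative to \<open>X\<close>; values of \<open>f\<close> outside \<open>X\<close> are irrelevant.\<close>

definition support_in :: "'a::euclidean_space set \<Rightarrow> ('a \<Rightarrow> real) \<Rightarrow> 'a set" where
  "support_in X f = X \<inter> closure {x \<in> X. f x \<noteq> 0}"

definition locally_L1 ::
    "'a::euclidean_space set \<Rightarrow> 'a measure \<Rightarrow> ('a \<Rightarrow> real) \<Rightarrow> bool" where
  "locally_L1 X M q \<longleftrightarrow> (\<forall>K. compact K \<and> K \<subseteq> X \<longrightarrow> set_integrable M K q)"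

text \<open>Local integrability of the weight is part of the notion. It also guarantees that both
  integrals below are integrals of integrable functions, so that no default value of the
  Bochner integral enters.\<close>

definition weighted_poincare ::
    "(complex ^ 'n::finite) set \<Rightarrow> (complex ^ 'n \<Rightarrow> complex ^ 'n \<Rightarrow> complex ^ 'n \<Rightarrow> real)
       \<Rightarrow> (complex ^ 'n \<Rightarrow> real) \<Rightarrow> bool" where
  "weighted_poincare X g q \<longleftrightarrow>
     locally_L1 X (riem_measure X g) q \<and>
     (\<forall>\<phi>. smooth_on X \<phi> \<and> compact (support_in X \<phi>) \<longrightarrow>
        (\<integral>z. q z * (\<phi> z)\<^sup>2 \<partial>riem_measure X g)
          \<le> (\<integral>z. g z (riem_grad g \<phi> z) (riem_grad g \<phi> z) \<partial>riem_measure X g))"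

text \<open>Complex hyperbolic space: the unit ball of complex \<open>n\<close>-space with the Bergman metric
  \<open>|dz|\<^sup>2 / (1 - |z|\<^sup>2) + |\<langle>dz, z\<rangle>|\<^sup>2 / (1 - |z|\<^sup>2)\<^sup>2\<close>. On the totally geodesic complex lines through the
  origin it restricts to \<open>|dz|\<^sup>2 / (1 - |z|\<^sup>2)\<^sup>2\<close>, of Gaussian curvature \<open>-4\<close>; by homogeneity this
  is the normalisation of holomorphic sectional curvature \<open>-4\<close>.\<close>

definition herm :: "complex ^ 'n::finite \<Rightarrow> complex ^ 'n \<Rightarrow> complex" where
  "herm v w = (\<Sum>i\<in>UNIV. v $ i * cnj (w $ i))"

definition CH :: "(complex ^ 'n::finite) set" where
  "CH = ball 0 1"

definition CH_metric ::
    "complex ^ 'n::finite \<Rightarrow> complex ^ 'n \<Rightarrow> complex ^ 'n \<Rightarrow> real" where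
  "CH_metric z v w =
     Re (herm v w) / (1 - (norm z)\<^sup>2) + Re (herm v z * herm z w) / (1 - (norm z)\<^sup>2)\<^sup>2"

end

theory Submission
  imports Defs
begin

text \<open>Put \<open>u = cosh\<^sup>2 r\<close>. In the ball model \<open>u\<close> is explicit for every base point \<open>a\<close>, and its
  Riemannian gradient is the polynomial field \<open>2 (1 - \<langle>z, a\<rangle>) (z - a) / (1 - |a|\<^sup>2)\<close>, with
  \<open>|\<nabla> u|\<^sup>2 = 4 u (u - 1)\<close> and \<open>\<Delta> u = 4 (n + 1) u - 4\<close>; so neither isometries nor polar coordinates
  are needed. For a field \<open>V\<close>, the divergence theorem applied to \<open>\<phi>\<^sup>2 V\<close> and Young's inequality give
  \<open>\<integral> (div V - |V|\<^sup>2) \<phi>\<^sup>2 \<le> \<integral> |\<nabla> \<phi>|\<^sup>2\<close>. The field \<open>V = F(u) \<nabla> u\<close> equal to \<open>- \<nabla> f / f\<close> for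
  \<open>f = (r / (sinh r ^ (2 n - 1) cosh r)) powr (1 / 2)\<close> satisfies \<open>div V - |V|\<^sup>2 = q\<close>. It is singular at
  \<open>a\<close>, so \<open>F(u)\<close> is replaced by \<open>F(u + e)\<close> and \<open>e\<close> tends to \<open>0\<close> by Fatou's lemma. Applied to cutoff
  functions, the same inequality gives the local integrability of \<open>q\<close>.\<close>

section \<open>Hermitian products and the Bergman metric\<close>

text \<open>The function \<open>f\<close> comes from geodesic spheres about the base point: their
  area is a constant times A = sinh r ^ (2n-1) cosh r, and f = sqrt (r / A). Substituting phi = psi
  / sqrt A makes the radial problem one-dimensional. There sqrt r is the Hardy function, responsible
  for 1 / (4 r^2), and the rest of \<open>q\<close> is (sqrt A)'' / sqrt A = n^2 + (n-1)^2 / sinh^2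
  r - 1 / sinh^2 (2r). Two obstacles shape the proof. The shift of \<open>u\<close> by
  \<open>e\<close> destroys the exact identity for \<open>q\<close>, and Fatou's lemma tolerates
  this only if every regularized integrand is nonnegative. Hence the sign lemmas for the coefficient
  and the weight, which rest on tanh x <= x <= sinh x at x = 2r. Nonnegativity of \<open>q\<close>
  is also what turns the inequality for one cutoff into a bound on the integral of |q|. Secondly,
  \<open>r\<close> is an infimum over curves and has to be matched with the explicit
  \<open>u\<close>: |grad r| = 1 bounds every curve length from below, and an explicit geodesic
  attains the bound.\<close>

lemma herm_add_left: "herm (v + w) z = herm v z + herm w z"
  by (simp add: herm_def sum.distrib distrib_right)

lemma herm_diff_left: "herm (v - w) z = herm v z - herm w z"
  by (simp add: herm_def sum_subtractf left_diff_distrib)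

lemma herm_scale_left: "herm (c *s v) w = c * herm v w"
  by (simp add: herm_def sum_distrib_left mult.assoc)

lemma herm_scale_right: "herm v (c *s w) = cnj c * herm v w"
  by (simp add: herm_def sum_distrib_left mult_ac)

lemma cnj_herm: "cnj (herm v w) = herm w v"
  by (simp add: herm_def mult.commute)

lemma Re_herm: "Re (herm v w) = v \<bullet> w"
  by (simp add: herm_def inner_vec_def inner_complex_def)

lemma herm_self: "herm v v = complex_of_real ((norm v)\<^sup>2)"
  by (rule complex_eqI) (simp_all add: Re_herm power2_norm_eq_inner, simp add: herm_def)

lemma Re_herm_mult: "Re (herm v z * herm z w) = (v \<bullet> z) * (w \<bullet> z) + (v \<bullet> (\<i> *s z)) * (w \<bullet> (\<i> *s z))"
proof -
  have "Im (herm v z) = v \<bullet> (\<i> *s z)" "Im (herm z w) = - (w \<bullet> (\<i> *s z))"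
    by (simp_all add: herm_scale_right flip: Re_herm cnj_herm[of w z])
  moreover have "Re (herm v z) = v \<bullet> z" "Re (herm z w) = w \<bullet> z"
    by (simp_all add: Re_herm inner_commute)
  ultimately show ?thesis by simp
qed

lemma bounded_linear_herm_left: "bounded_linear (\<lambda>v. herm v w)"
  unfolding herm_def
  by (intro bounded_linear_sum bounded_linear_mult_const bounded_linear_vec_nth)

lemma bounded_linear_vector_scale: "bounded_linear (\<lambda>c::complex. c *s (w::complex^'n::finite))"
  by (rule linear_conv_bounded_linear[THEN iffD1])
     (auto intro!: linearI simp: vector_sadd_rdistrib vec_eq_iff)

lemma norm_vector_scale: "norm (c *s (w::complex^'n::finite)) = cmod c * norm w"
proof -
  have "complex_of_real ((norm (c *s w))\<^sup>2) = c * cnj c * herm w w"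
    by (simp only: herm_scale_left herm_scale_right mult_ac flip: herm_self)
  also have "\<dots> = complex_of_real ((cmod c * norm w)\<^sup>2)"
    by (simp add: herm_self power_mult_distrib flip: complex_norm_square)
  finally have "(norm (c *s w))\<^sup>2 = (cmod c * norm w)\<^sup>2"
    using of_real_eq_iff by blast
  then show ?thesis by simp
qed

text \<open>The real Cauchy-Schwarz inequality applied to \<open>v\<close> multiplied by the
  conjugate of \<open>herm v w\<close>, which makes the Hermitian product real and
  nonnegative.\<close>

lemma norm_herm_le: "cmod (herm v w) \<le> norm v * norm w"
proof (cases "herm v w = 0")
  case False
  have "cmod (herm v w) * cmod (herm v w) = Re (cnj (herm v w) * herm v w)"
    by (metis Re_complex_of_real complex_norm_square mult.commute power2_eq_square)
  also have "\<dots> = (cnj (herm v w) *s v) \<bullet> w"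
    by (simp add: herm_scale_left flip: Re_herm)
  also have "\<dots> \<le> norm (cnj (herm v w) *s v) * norm w" by (rule norm_cauchy_schwarz)
  also have "\<dots> = cmod (herm v w) * (norm v * norm w)" by (simp add: norm_vector_scale)
  finally show ?thesis using False by simp
qed simp

text \<open>The projective distance formula |<Z,A>|^2 / (<Z,Z> <A,A>) for the lifts Z = (1, z), A =
  (1, a) and the Hermitian form of signature (1, n) on (n + 1)-space. That it is cosh^2 of the
  Riemannian distance is proved only in \<open>riem_dist_CH\<close>.\<close>

definition cosh2_dist :: "complex^'n::finite \<Rightarrow> complex^'n \<Rightarrow> real" where
  "cosh2_dist a z = (cmod (1 - herm z a))\<^sup>2 / ((1 - (norm z)\<^sup>2) * (1 - (norm a)\<^sup>2))"

definition grad_cosh2 :: "complex^'n::finite \<Rightarrow> complex^'n \<Rightarrow> complex^'n" where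
  "grad_cosh2 a z = (2 * (1 - herm z a) / (1 - (norm a)\<^sup>2)) *s (z - a)"

lemma CH_iff_norm: "z \<in> CH \<longleftrightarrow> norm z < 1"
  by (simp add: CH_def)

lemma CH_pos: "z \<in> CH \<Longrightarrow> 0 < 1 - (norm z)\<^sup>2"
  by (simp add: CH_iff_norm abs_square_less_1)

lemma one_minus_herm_nonzero: "a \<in> CH \<Longrightarrow> z \<in> CH \<Longrightarrow> Re (1 - herm z a) > 0"
proof -
  assume "a \<in> CH" "z \<in> CH"
  then have "norm z * norm a < 1"
    using mult_strict_mono'[of "norm z" 1 "norm a" 1] by (simp add: CH_iff_norm)
  then show ?thesis
    using norm_herm_le[of z a] abs_Re_le_cmod[of "herm z a"] by simp
qed

section \<open>Real form and positivity of the Bergman metric\<close>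

lemma CH_metric_commute: "CH_metric z v w = CH_metric z w v"
  by (simp only: CH_metric_def Re_herm inner_commute Re_herm_mult mult.commute)

text \<open>Over the reals the metric is a multiple of the Euclidean one plus two rank-one forms,
  along z and i z. Bilinearity and positivity can be read off, and the Gram determinant becomes
  computable.\<close>

lemma CH_metric_alt: "CH_metric z v w = (v \<bullet> w) / (1 - (norm z)\<^sup>2)
    + ((v \<bullet> z) * (w \<bullet> z) + (v \<bullet> (\<i> *s z)) * (w \<bullet> (\<i> *s z))) / (1 - (norm z)\<^sup>2)\<^sup>2"
  by (simp only: CH_metric_def Re_herm Re_herm_mult)

lemma CH_metric_ge: assumes "z \<in> CH" shows "CH_metric z v v \<ge> (norm v)\<^sup>2"
proof -
  have "(norm v)\<^sup>2 \<le> (norm v)\<^sup>2 / (1 - (norm z)\<^sup>2)"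
    using CH_pos[OF assms] by (simp add: field_simps mult_left_le)
  then show ?thesis
    by (simp add: CH_metric_alt flip: power2_norm_eq_inner) (smt (verit) divide_nonneg_nonneg sum_squares_ge_zero zero_le_power2)
qed

lemma CH_metric_nonneg: "z \<in> CH \<Longrightarrow> CH_metric z v v \<ge> 0"
  using CH_metric_ge[of z v] by (smt (verit) zero_le_power2)

lemma CH_metric_pos: "z \<in> CH \<Longrightarrow> v \<noteq> 0 \<Longrightarrow> CH_metric z v v > 0"
  using CH_metric_ge[of z v] by (smt (verit) zero_less_norm_iff zero_less_power)

lemma CH_metric_add_left: "CH_metric z (v + w) x = CH_metric z v x + CH_metric z w x"
  by (simp add: CH_metric_alt inner_add_left add_divide_distrib algebra_simps)

lemma CH_metric_scaleR_left: "CH_metric z (t *\<^sub>R v) x = t * CH_metric z v x"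
  by (simp add: CH_metric_alt algebra_simps)

lemma CH_metric_scaleR_right: "CH_metric z v (t *\<^sub>R x) = t * CH_metric z v x"
  by (simp add: CH_metric_alt algebra_simps)

lemma CH_metric_add_right: "CH_metric z x (v + w) = CH_metric z x v + CH_metric z x w"
  by (metis CH_metric_add_left CH_metric_commute)

lemma CH_metric_Young:
  assumes "z \<in> CH"
  shows "- 2 * CH_metric z v w \<le> CH_metric z v v + CH_metric z w w"
  using CH_metric_nonneg[OF assms, of "v + w"] CH_metric_commute[of z v w]
  by (simp add: CH_metric_add_left CH_metric_add_right)

lemma CH_metric_Cauchy_Schwarz:
  assumes z: "z \<in> CH"
  shows "\<bar>CH_metric z v w\<bar> \<le> sqrt (CH_metric z v v) * sqrt (CH_metric z w w)"
proof (cases "w = 0")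
  case True
  then show ?thesis by (simp add: CH_metric_alt)
next
  case False
  define g where "g = CH_metric z"
  have p: "g w w > 0" unfolding g_def by (rule CH_metric_pos[OF z False])
  define t where "t = - g v w / g w w"
  have "0 \<le> g (v + t *\<^sub>R w) (v + t *\<^sub>R w)"
    unfolding g_def by (rule CH_metric_nonneg[OF z])
  also have "\<dots> = g v v + 2 * t * g v w + t * t * g w w"
    using CH_metric_commute[of z w v]
    by (simp add: g_def CH_metric_add_left CH_metric_add_right CH_metric_scaleR_left CH_metric_scaleR_right algebra_simps)
  also have "\<dots> = g v v - (g v w)\<^sup>2 / g w w"
    using p by (simp add: t_def power2_eq_square field_simps)
  finally have "(g v w)\<^sup>2 \<le> g v v * g w w" using p by (simp add: field_simps)
  then have "sqrt ((g v w)\<^sup>2) \<le> sqrt (g v v * g w w)" by (rule real_sqrt_le_mono)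
  then show ?thesis by (simp add: g_def real_sqrt_mult)
qed

section \<open>Gradient of cosh^2 r, its norm, and the range of cosh^2 r\<close>

lemma has_derivative_norm_sq: "((\<lambda>z. (norm z)\<^sup>2) has_derivative (\<lambda>v. 2 * (v \<bullet> z))) (at (z::'a::real_inner) within S)"
  unfolding power2_norm_eq_inner by (auto intro!: derivative_eq_intros simp: inner_commute)

lemma has_derivative_cosh2_dist:
  assumes a: "a \<in> CH" and z: "z \<in> CH"
  shows "(cosh2_dist a has_derivative CH_metric z (grad_cosh2 a z)) (at z)"
proof -
  define D where "D = 1 - (norm z)\<^sup>2"
  define s where "s = 1 - (norm a)\<^sup>2"
  define k where "k = 2 / s"
  define b where "b = 1 - herm z a"
  have D: "D > 0" and s: "s > 0" using CH_pos a z by (auto simp: D_def s_def)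
  have h: "((\<lambda>z. herm z a) has_derivative (\<lambda>v. herm v a)) (at z)"
    by (rule bounded_linear_imp_has_derivative[OF bounded_linear_herm_left])
  have n2: "((\<lambda>z. (cmod (1 - herm z a))\<^sup>2) has_derivative (\<lambda>v. 2 * (- herm v a \<bullet> b))) (at z)"
    unfolding b_def
    by (rule has_derivative_compose[of "\<lambda>z. 1 - herm z a", OF _ has_derivative_norm_sq])
       (auto intro!: derivative_eq_intros h)
  have d: "((\<lambda>z. (1 - (norm z)\<^sup>2) * s) has_derivative (\<lambda>v. - (2 * (v \<bullet> z)) * s)) (at z)"
    by (auto intro!: derivative_eq_intros has_derivative_norm_sq simp: inner_commute)
  have d1: "(cosh2_dist a has_derivative (\<lambda>v. (2 * (- herm v a \<bullet> b) * (D * s) - (cmod b)\<^sup>2 * (- (2 * (v \<bullet> z)) * s)) / (D * s * (D * s)))) (at z)"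
    unfolding cosh2_dist_def[abs_def] s_def[symmetric] D_def b_def
    by (rule has_derivative_divide'[OF n2 d, unfolded b_def]) (use D s in \<open>auto simp: D_def\<close>)
  have d2: "(2 * (- herm v a \<bullet> b) * (D * s) - (cmod b)\<^sup>2 * (- (2 * (v \<bullet> z)) * s)) / (D * s * (D * s)) = CH_metric z (grad_cosh2 a z) v" for v
  proof -
    have nz: "(norm z)\<^sup>2 = 1 - D" by (simp add: D_def)
    have c: "herm a z = 1 - cnj b" by (simp add: b_def cnj_herm)
    define N where "N = (cmod b)\<^sup>2"
    have bb: "b * cnj b = of_real N" by (simp add: N_def complex_norm_square del: of_real_power)
    have G: "grad_cosh2 a z = (of_real k * b) *s (z - a)"
      by (simp add: grad_cosh2_def b_def s_def k_def)
    have e1: "herm (grad_cosh2 a z) v = of_real k * (b * (herm z v - herm a v))"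
      by (simp only: G herm_scale_left herm_diff_left mult.assoc)
    \<comment> \<open>The product with z is needed for the second term of the metric. It collapses
      because <a,z> = 1 - cnj b and b * cnj b = N, so that both sides of the claim become rational
      in D, s, N and the real parts of b <z,v> and b <a,v>.\<close>
    have "herm (grad_cosh2 a z) z = of_real k * (b * (of_real (1 - D) - (1 - cnj b)))"
      by (simp only: G herm_scale_left herm_diff_left herm_self c nz mult.assoc)
    also have "\<dots> = of_real k * (of_real N - of_real D * b)"
      by (simp only: flip: bb) (simp add: algebra_simps)
    finally have e: "herm (grad_cosh2 a z) z = of_real k * (of_real N - of_real D * b)" .
    have e2: "Re (herm (grad_cosh2 a z) z * herm z v) = k * (N * Re (herm z v) - D * Re (b * herm z v))"
      unfolding e by (simp add: algebra_simps)
    have e3: "- herm v a \<bullet> b = - Re (b * herm a v)"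
      by (simp add: inner_complex_def flip: cnj_herm[of v a])
    have e4: "Re (herm z v) = v \<bullet> z" by (simp add: Re_herm inner_commute)
    have e1': "Re (herm (grad_cosh2 a z) v) = k * (Re (b * herm z v) - Re (b * herm a v))"
      by (simp add: e1 algebra_simps)
    show ?thesis
      unfolding CH_metric_def e2 e1' e3 e4 D_def[symmetric] N_def[symmetric] k_def using D s
      by (simp add: divide_simps) (simp add: power2_eq_square algebra_simps)
  qed
  show ?thesis
    by (rule has_derivative_eq_rhs[OF d1]) (rule ext, rule d2)
qed

text \<open>This is the eikonal equation |grad r| = 1 in terms of u = cosh^2 r, because (du/dr)^2 =
  4 cosh^2 r sinh^2 r. The metric enters the later distance estimates and the divergence computation
  mainly through it.\<close>

lemma CH_metric_grad_cosh2:
  assumes a: "a \<in> CH" and z: "z \<in> CH"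
  shows "CH_metric z (grad_cosh2 a z) (grad_cosh2 a z) = 4 * cosh2_dist a z * (cosh2_dist a z - 1)"
proof -
  define D where "D = 1 - (norm z)\<^sup>2"
  define s where "s = 1 - (norm a)\<^sup>2"
  define k where "k = 2 / s"
  define b where "b = 1 - herm z a"
  define N where "N = (cmod b)\<^sup>2"
  have D: "D > 0" and s: "s > 0" using CH_pos a z by (auto simp: D_def s_def)
  have nz: "(norm z)\<^sup>2 = 1 - D" and na: "(norm a)\<^sup>2 = 1 - s" by (simp_all add: D_def s_def)
  have c: "herm a z = 1 - cnj b" "herm z a = 1 - b" by (simp_all add: b_def cnj_herm)
  have bb: "b * cnj b = of_real N" by (simp add: N_def complex_norm_square del: of_real_power)
  have G: "grad_cosh2 a z = (of_real k * b) *s (z - a)"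
    by (simp add: grad_cosh2_def b_def s_def k_def)
  \<comment> \<open>Expands |z - a|^2 = |z|^2 + |a|^2 - 2 Re <z,a> with |z|^2 = 1 - D, |a|^2 = 1 - s
    and <z,a> = 1 - b.\<close>
  have n: "herm (z - a) (z - a) = of_real (2 * Re b - D - s)"
    unfolding herm_self
    by (simp add: power2_norm_eq_inner inner_diff_left inner_diff_right b_def D_def s_def Re_herm inner_commute)
  have "herm (grad_cosh2 a z) (grad_cosh2 a z) = of_real (k\<^sup>2) * (b * cnj b) * herm (z - a) (z - a)"
    by (simp only: G herm_scale_left herm_scale_right) (simp add: power2_eq_square)
  then have 1: "Re (herm (grad_cosh2 a z) (grad_cosh2 a z)) = k\<^sup>2 * N * (2 * Re b - D - s)"
    by (simp add: bb n del: of_real_power)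
  have "herm (grad_cosh2 a z) z = of_real k * (b * (of_real (1 - D) - (1 - cnj b)))"
    by (simp only: G herm_scale_left herm_diff_left herm_self c nz mult.assoc)
  also have "\<dots> = of_real k * (of_real N - of_real D * b)"
    by (simp only: flip: bb) (simp add: algebra_simps)
  finally have e: "herm (grad_cosh2 a z) z = of_real k * (of_real N - of_real D * b)" .
  have "herm (grad_cosh2 a z) z * herm z (grad_cosh2 a z) = of_real (k\<^sup>2) * (of_real N - of_real D * b) * (of_real N - of_real D * cnj b)"
    by (simp add: e power2_eq_square algebra_simps flip: cnj_herm[of "grad_cosh2 a z" z])
  also have "\<dots> = of_real (k\<^sup>2) * (of_real (N\<^sup>2) - of_real (N * D) * (b + cnj b) + of_real (D\<^sup>2) * (b * cnj b))"
    by (simp add: power2_eq_square algebra_simps)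
  finally have 2: "Re (herm (grad_cosh2 a z) z * herm z (grad_cosh2 a z)) = k\<^sup>2 * (N\<^sup>2 - 2 * N * D * Re b + D\<^sup>2 * N)"
    by (simp add: bb del: of_real_power)
  have u: "cosh2_dist a z = N / (D * s)"
    by (simp add: cosh2_dist_def N_def b_def D_def s_def)
  show ?thesis
    unfolding CH_metric_def 1 2 u D_def[symmetric] k_def using D s
    by (simp add: divide_simps) (simp add: power2_eq_square algebra_simps)
qed

text \<open>Read off from the eikonal equation: u is positive and 4 u (u - 1) is the squared norm of
  its gradient. The gradient vanishes only at \<open>a\<close>, which gives strictness
  elsewhere.\<close>

lemma cosh2_dist_ge_1:
  assumes a: "a \<in> CH" and z: "z \<in> CH"
  shows "cosh2_dist a z \<ge> 1" and "z \<noteq> a \<Longrightarrow> cosh2_dist a z > 1"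
proof -
  define u where "u = cosh2_dist a z"
  have "1 - herm z a \<noteq> 0" using one_minus_herm_nonzero[OF a z] by auto
  then have u: "u > 0" using CH_pos[OF a] CH_pos[OF z]
    by (simp add: u_def cosh2_dist_def)
  have *: "4 * u * (u - 1) \<ge> 0"
    unfolding u_def CH_metric_grad_cosh2[OF a z, symmetric] by (rule CH_metric_nonneg[OF z])
  then show "cosh2_dist a z \<ge> 1" using u by (simp add: u_def[symmetric] zero_le_mult_iff)
  assume "z \<noteq> a"
  then have "grad_cosh2 a z \<noteq> 0"
    using one_minus_herm_nonzero[OF a z] CH_pos[OF a]
    by (auto simp: grad_cosh2_def complex_eq_iff)
  then have "4 * u * (u - 1) > 0"
    unfolding u_def CH_metric_grad_cosh2[OF a z, symmetric] by (rule CH_metric_pos[OF z])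
  then show "cosh2_dist a z > 1" using u by (simp add: u_def[symmetric] zero_less_mult_iff)
qed

lemma cosh2_dist_self: "a \<in> CH \<Longrightarrow> cosh2_dist a a = 1"
proof -
  assume "a \<in> CH"
  moreover have "1 - herm a a = of_real (1 - (norm a)\<^sup>2)" by (simp add: herm_self)
  ultimately show ?thesis
    using CH_pos[of a] by (simp only: cosh2_dist_def norm_of_real power2_abs) (simp add: power2_eq_square)
qed

section \<open>The radial coefficient\<close>

text \<open>The argument \<open>w\<close> stands for \<open>cosh\<^sup>2 r\<close>.\<close>

definition dist_of :: "real \<Rightarrow> real" where
  "dist_of w = arcosh (2 * w - 1) / 2"

text \<open>With A = sinh r ^ (2n-1) cosh r, the radial derivative of - log f is A' / (2A) - 1 /
  (2r), and A' / (2A) = (2 n w - 1) / (2 sqrt (w (w-1))). Division by du/dr = 2 sqrt (w (w-1)) turns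
  this into a coefficient of grad u.\<close>

definition field_coeff :: "real \<Rightarrow> real \<Rightarrow> real" where
  "field_coeff n w = (2 * n * w - 1) / (4 * w * (w - 1)) - 1 / (4 * dist_of w * sqrt (w * (w - 1)))"

definition field_coeff' :: "real \<Rightarrow> real \<Rightarrow> real" where
  "field_coeff' n w = (2 * n * (w * (w - 1)) - (2 * n * w - 1) * (2 * w - 1)) / (4 * (w * (w - 1))\<^sup>2)
     + (1 / 2 + dist_of w * (2 * w - 1) / (2 * sqrt (w * (w - 1)))) / (4 * (dist_of w)\<^sup>2 * (w * (w - 1)))"

text \<open>The weight of the theorem rewritten with sinh^2 r = w - 1 and sinh^2 (2r) = 4 w
  (w-1).\<close>

definition weight :: "real \<Rightarrow> real \<Rightarrow> real" where
  "weight n w = n\<^sup>2 + 1 / (4 * (dist_of w)\<^sup>2) + (n - 1)\<^sup>2 / (w - 1) - 1 / (4 * w * (w - 1))"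

lemma dist_of_nonneg: "w \<ge> 1 \<Longrightarrow> dist_of w \<ge> 0"
  by (simp add: dist_of_def)

lemma dist_of_pos: "w > 1 \<Longrightarrow> dist_of w > 0"
  by (simp add: dist_of_def)

lemma dist_of_1: "dist_of 1 = 0"
  by (simp add: dist_of_def)

lemma cosh_double_dist_of: "w \<ge> 1 \<Longrightarrow> cosh (2 * dist_of w) = 2 * w - 1"
  by (simp add: dist_of_def)

lemma sinh_double_dist_of_sq: "w \<ge> 1 \<Longrightarrow> (sinh (2 * dist_of w))\<^sup>2 = 4 * w * (w - 1)"
  using cosh_square_eq[of "2 * dist_of w"]
  by (simp only: cosh_double_dist_of) (simp add: power2_eq_square algebra_simps)

lemma sinh_dist_of_sq: "w \<ge> 1 \<Longrightarrow> (sinh (dist_of w))\<^sup>2 = w - 1"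
  using cosh_double_cosh[of "dist_of w"] cosh_double_dist_of[of w] cosh_square_eq[of "dist_of w"]
  by simp

lemma DERIV_dist_of:
  assumes "w > 1" shows "(dist_of has_field_derivative 1 / (2 * sqrt (w * (w - 1)))) (at w)"
proof -
  have "sqrt ((2 * w - 1)\<^sup>2 - 1) = sqrt (2\<^sup>2 * (w * (w - 1)))"
    by (simp add: power2_eq_square algebra_simps)
  also have "\<dots> = 2 * sqrt (w * (w - 1))"
    by (simp only: real_sqrt_mult real_sqrt_abs)
  finally have eq: "sqrt ((2 * w - 1)\<^sup>2 - 1) = 2 * sqrt (w * (w - 1))" .
  have "((\<lambda>w. arcosh (2 * w - 1)) has_field_derivative 1 / sqrt ((2 * w - 1)\<^sup>2 - 1) * 2) (at w)"
    by (rule DERIV_chain2[OF arcosh_real_has_field_derivative])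
       (use assms in \<open>auto intro!: derivative_eq_intros\<close>)
  from DERIV_cdivide[OF this, of 2] show ?thesis
    unfolding dist_of_def[abs_def] by (rule DERIV_cong) (simp add: eq)
qed

lemma continuous_on_dist_of: "continuous_on {1..} dist_of"
  unfolding dist_of_def[abs_def] by (intro continuous_intros) auto

lemma DERIV_field_coeff:
  assumes w: "w > 1" shows "(field_coeff n has_field_derivative field_coeff' n w) (at w)"
proof -
  define S where "S = sqrt (w * (w - 1))"
  have P: "w * (w - 1) > 0" using w by simp
  have S: "S > 0" and S2: "S\<^sup>2 = w * (w - 1)" using P by (simp_all add: S_def)
  have R: "dist_of w > 0" by (rule dist_of_pos[OF w])
  have 1: "((\<lambda>w. 4 * dist_of w * sqrt (w * (w - 1))) has_field_derivative
     4 * (1 / (2 * S) * S + dist_of w * ((2 * w - 1) / (2 * S)))) (at w)"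
    unfolding S_def using P
    by (auto intro!: derivative_eq_intros DERIV_dist_of w simp: field_simps)
  have 2: "((\<lambda>w. 1 / (4 * dist_of w * sqrt (w * (w - 1)))) has_field_derivative
      - (4 * (1 / (2 * S) * S + dist_of w * ((2 * w - 1) / (2 * S)))) / (4 * dist_of w * S)\<^sup>2) (at w)"
    using DERIV_inverse_fun[OF 1] R S
    by (simp add: S_def[symmetric] divide_simps power2_eq_square)
  have 3: "((\<lambda>w. (2 * n * w - 1) / (4 * w * (w - 1))) has_field_derivative
      (2 * n * (w * (w - 1)) - (2 * n * w - 1) * (2 * w - 1)) / (4 * (w * (w - 1))\<^sup>2)) (at w)"
    using w by (auto intro!: derivative_eq_intros simp: divide_simps power2_eq_square) (simp add: algebra_simps)
  have e: "(4 * (1 / (2 * S) * S + dist_of w * ((2 * w - 1) / (2 * S)))) / (4 * dist_of w * S)\<^sup>2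
     = (1 / 2 + dist_of w * (2 * w - 1) / (2 * S)) / (4 * (dist_of w)\<^sup>2 * S\<^sup>2)"
    using R S by (simp add: divide_simps power2_eq_square)
  show ?thesis
    unfolding field_coeff_def[abs_def] field_coeff'_def S_def[symmetric]
    by (rule DERIV_cong[OF DERIV_diff[OF 3 2]])
       (simp only: e S2 diff_minus_eq_add flip: minus_divide_left)
qed

lemma continuous_on_field_coeff: "continuous_on {1<..} (field_coeff n)"
  by (auto intro!: continuous_at_imp_continuous_on DERIV_isCont DERIV_field_coeff)

lemma continuous_on_field_coeff': "continuous_on {1<..} (field_coeff' n)"
proof -
  have "continuous_on {1<..} dist_of"
    by (rule continuous_on_subset[OF continuous_on_dist_of]) auto
  then show ?thesis
    unfolding field_coeff'_def[abs_def]
    by (intro continuous_intros) (auto dest: dist_of_pos)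
qed

text \<open>By the chain rule, |grad u|^2 = 4 u (u-1) and the formula for the Laplacian of u, the
  left-hand side is div V - |V|^2 for V = F(u) grad u, evaluated at u = w.\<close>

lemma Riccati_field_coeff:
  assumes w: "w > 1"
  shows "4 * w * (w - 1) * (field_coeff' n w - (field_coeff n w)\<^sup>2)
    + field_coeff n w * (4 * (n + 1) * w - 4) = weight n w"
proof -
  define S where "S = sqrt (w * (w - 1))"
  define R where "R = dist_of w"
  define P where "P = w * (w - 1)"
  have P: "P > 0" using w by (simp add: P_def)
  have S: "S > 0" and S2: "S * S = P" using P by (simp_all add: S_def P_def)
  have R: "R > 0" using dist_of_pos[OF w] by (simp add: R_def)
  have f: "field_coeff n w = (2 * n * w - 1) / (4 * P) - S / (4 * R * P)"
    unfolding field_coeff_def S_def[symmetric] R_def[symmetric]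
    using S R P S2 by (simp add: P_def[symmetric] mult.assoc divide_simps) (simp add: algebra_simps)
  have f': "field_coeff' n w = (2 * n * P - (2 * n * w - 1) * (2 * w - 1)) / (4 * P\<^sup>2)
     + (P / 2 + R * (2 * w - 1) * S / 2) / (4 * R\<^sup>2 * P\<^sup>2)"
    unfolding field_coeff'_def S_def[symmetric] unfolding R_def[symmetric] P_def[symmetric]
    using S R P S2 by (simp add: divide_simps) (simp add: algebra_simps power2_eq_square)
  have e: "weight n w = n\<^sup>2 + 1 / (4 * R\<^sup>2) + (n - 1)\<^sup>2 * w / P - 1 / (4 * P)"
    unfolding weight_def R_def[symmetric] P_def using w by simp
  have "(field_coeff n w)\<^sup>2 = ((2 * n * w - 1)\<^sup>2 / (16 * P\<^sup>2)) - (2 * n * w - 1) * S / (8 * R * P\<^sup>2) + 1 / (16 * R\<^sup>2 * P)"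
    unfolding f using S R P S2 by (simp add: divide_simps power2_eq_square) (simp add: algebra_simps)
  then have "4 * P * (field_coeff' n w - (field_coeff n w)\<^sup>2) + field_coeff n w * (4 * (n + 1) * w - 4)
    = (2 * n * P - (2 * n * w - 1) * (2 * w - 1)) / P + 1 / (2 * R\<^sup>2) + (2 * w - 1) * S / (2 * R * P)
      - (2 * n * w - 1)\<^sup>2 / (4 * P) + (2 * n * w - 1) * S / (2 * R * P) - 1 / (4 * R\<^sup>2)
      + (2 * n * w - 1) * ((n + 1) * w - 1) / P - S * ((n + 1) * w - 1) / (R * P)"
    unfolding f f' using R P by (simp add: divide_simps power2_eq_square) (simp add: algebra_simps)
  \<comment> \<open>The three terms with S / (R P) cancel because (2w - 1) + (2nw - 1) = 2 ((n+1) w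
    - 1). Of the pure 1 / R^2 terms, 1/2 - 1/4 = 1/4 survives, which is the Hardy constant.\<close>
  also have "\<dots> = ((2 * n * P - (2 * n * w - 1) * (2 * w - 1)) - (2 * n * w - 1)\<^sup>2 / 4 + (2 * n * w - 1) * ((n + 1) * w - 1)) / P + 1 / (4 * R\<^sup>2)"
    using R P by (simp add: divide_simps) (simp add: algebra_simps power2_eq_square)
  also have "\<dots> = (n\<^sup>2 * P + (n - 1)\<^sup>2 * w - 1 / 4) / P + 1 / (4 * R\<^sup>2)"
    by (rule arg_cong[of _ _ "\<lambda>x. x / P + _"]) (simp add: P_def power2_eq_square field_simps)
  also have "\<dots> = weight n w"
    unfolding e using R P by (simp add: divide_simps) (simp add: algebra_simps)
  finally show ?thesis by (simp add: P_def mult.assoc)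
qed

section \<open>Signs of the coefficient and of the weight\<close>

lemma sinh_le_mult_cosh:
  fixes x :: real assumes "0 \<le> x" shows "sinh x \<le> x * cosh x"
proof -
  have "\<exists>d. ((\<lambda>x. x * cosh x - sinh x) has_real_derivative d) (at y) \<and> 0 \<le> d" if "0 \<le> y" for y :: real
    by (rule exI[of _ "y * sinh y"]) (use that in \<open>auto intro!: derivative_eq_intros\<close>)
  from DERIV_nonneg_imp_nondecreasing[OF assms this] show ?thesis by simp
qed

lemma le_sinh:
  fixes x :: real assumes "0 \<le> x" shows "x \<le> sinh x"
proof -
  have "\<exists>d. ((\<lambda>x. sinh x - x) has_real_derivative d) (at y) \<and> 0 \<le> d" if "0 \<le> y" for y :: real
    by (rule exI[of _ "cosh y - 1"]) (auto intro!: derivative_eq_intros cosh_real_ge_1)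
  from DERIV_nonneg_imp_nondecreasing[OF assms this] show ?thesis by simp
qed

lemma sinh_double_dist_of: "w \<ge> 1 \<Longrightarrow> sinh (2 * dist_of w) = 2 * sqrt (w * (w - 1))"
proof -
  assume w: "w \<ge> 1"
  have "(sinh (2 * dist_of w))\<^sup>2 = (2 * sqrt (w * (w - 1)))\<^sup>2"
    using w by (simp add: sinh_double_dist_of_sq power_mult_distrib)
  then show ?thesis
    using w by (subst (asm) power2_eq_iff_nonneg) (auto simp: dist_of_nonneg)
qed

text \<open>For n = 1 this is sinh x <= x cosh x at x = 2r, since 2 w - 1 = cosh (2r) and 2 sqrt (w
  (w-1)) = sinh (2r). A larger n only increases the first fraction.\<close>

lemma field_coeff_nonneg:
  assumes "n \<ge> 1" "w > 1" shows "field_coeff n w \<ge> 0"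
proof -
  define S where "S = sqrt (w * (w - 1))"
  have P: "w * (w - 1) > 0" using assms by simp
  have S: "S > 0" and S2: "S * S = w * (w - 1)" using P by (simp_all add: S_def)
  have R: "dist_of w > 0" using assms dist_of_pos by simp
  have "2 * S \<le> 2 * dist_of w * (2 * w - 1)"
    using sinh_le_mult_cosh[of "2 * dist_of w"] assms R
    by (simp add: sinh_double_dist_of cosh_double_dist_of S_def)
  also have "\<dots> \<le> 2 * dist_of w * (2 * n * w - 1)"
    using R assms by (intro mult_left_mono) auto
  finally have "1 / (4 * dist_of w * S) \<le> (2 * n * w - 1) / (4 * (S * S))"
    using R S by (simp add: divide_simps) (simp add: algebra_simps)
  then show ?thesis by (simp add: field_coeff_def S_def[symmetric] S2 mult.assoc)
qed

text \<open>The only negative term is 1 / sinh^2 (2r), and it is dominated by the Hardy term 1 /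
  (2r)^2 because 2r <= sinh (2r).\<close>

lemma weight_nonneg:
  assumes "w > 1" shows "weight n w \<ge> 0"
proof -
  have R: "dist_of w > 0" using assms dist_of_pos by simp
  have "(2 * dist_of w)\<^sup>2 \<le> (sinh (2 * dist_of w))\<^sup>2"
    using le_sinh[of "2 * dist_of w"] R by (intro power_mono) auto
  then have "1 / (4 * w * (w - 1)) \<le> 1 / (4 * (dist_of w)\<^sup>2)"
    using assms R by (intro divide_left_mono) (auto simp: sinh_double_dist_of_sq power_mult_distrib)
  moreover have "n\<^sup>2 + (n - 1)\<^sup>2 / (w - 1) \<ge> 0" using assms by auto
  ultimately show ?thesis unfolding weight_def by linarith
qed

text \<open>The value of div V - |V|^2 for V = F(u + e) grad u. Only the coefficient is shifted:
  |grad u|^2 and the Laplacian keep the original u, so the Riccati identity does not apply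
  directly.\<close>

definition regularized_weight :: "real \<Rightarrow> real \<Rightarrow> real \<Rightarrow> real" where
  "regularized_weight n e u = 4 * u * (u - 1) * (field_coeff' n (u + e) - (field_coeff n (u + e))\<^sup>2)
     + field_coeff n (u + e) * (4 * (n + 1) * u - 4)"

text \<open>The shift \<open>u + e\<close> leaves nonnegative multiples of \<open>weight n (u + e)\<close> and of the coefficient;
  this sign is what makes Fatou's lemma applicable as \<open>e\<close> tends to \<open>0\<close>.\<close>

lemma regularized_weight_nonneg:
  assumes n: "n \<ge> 1" and u: "u \<ge> 1" and e: "e > 0"
  shows "regularized_weight n e u \<ge> 0"
proof -
  define w where "w = u + e"
  \<comment> \<open>The ratio of |grad u|^2 at u to its formal value at w. Multiplying the Riccati
    identity at w by \<open>t\<close> leaves the coefficient times the difference of the Laplacian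
    at u and \<open>t\<close> times the Laplacian formula at w; that difference has to be shown
    nonnegative.\<close>
  define t where "t = u * (u - 1) / (w * (w - 1))"
  have w: "w > 1" using u e by (simp add: w_def)
  have t: "t \<ge> 0" using u w by (simp add: t_def)
  have tw: "4 * u * (u - 1) = t * (4 * w * (w - 1))" proof -
    have "t * (w * (w - 1)) = u * (u - 1)" using w by (simp add: t_def)
    then have "4 * u * (u - 1) = 4 * (t * (w * (w - 1)))" by simp
    then show ?thesis by (simp only: mult_ac)
  qed
  have "regularized_weight n e u = t * (4 * w * (w - 1) * (field_coeff' n w - (field_coeff n w)\<^sup>2)) + field_coeff n w * (4 * (n + 1) * u - 4)"
    unfolding regularized_weight_def w_def[symmetric] tw by simp
  also have "4 * w * (w - 1) * (field_coeff' n w - (field_coeff n w)\<^sup>2) = weight n w - field_coeff n w * (4 * (n + 1) * w - 4)"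
    using Riccati_field_coeff[OF w, of n] by simp
  finally have eq: "regularized_weight n e u = t * weight n w + field_coeff n w * ((4 * (n + 1) * u - 4) - t * (4 * (n + 1) * w - 4))"
    by (simp add: algebra_simps)
  have t1: "u - t * w = e * u / (w - 1)" "1 - t = e * (w + u - 1) / (w * (w - 1))"
    using w by (simp_all add: t_def divide_simps) (simp_all add: w_def algebra_simps)
  \<comment> \<open>After clearing the denominator this is (u - 1) (w - 1) >= 0. It bounds the
    subtracted part of the remainder by u, which (n + 1) u exceeds.\<close>
  have "(w + u - 1) / w \<le> u"
  proof -
    have "(u - 1) * (w - 1) \<ge> 0" using u w by simp
    then show ?thesis using w by (simp add: divide_simps algebra_simps)
  qed
  then have "0 \<le> 4 * e / (w - 1) * ((n + 1) * u - (w + u - 1) / w)"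
    using u n e w by (intro mult_nonneg_nonneg) (auto simp: algebra_simps intro: order_trans[of _ u] add_increasing)
  also have "\<dots> = 4 * (n + 1) * (u - t * w) - 4 * (1 - t)"
    unfolding t1 using w by (simp add: divide_simps) (simp add: algebra_simps)
  finally have "(4 * (n + 1) * u - 4) - t * (4 * (n + 1) * w - 4) \<ge> 0"
    by (simp add: algebra_simps)
  then show ?thesis
    unfolding eq using t weight_nonneg[OF w] field_coeff_nonneg[OF n w] by simp
qed

lemma continuous_on_regularized_weight:
  assumes "e > 0" shows "continuous_on {1..} (regularized_weight n e)"
proof -
  have "continuous_on {1..} (\<lambda>u. field_coeff n (u + e))" "continuous_on {1..} (\<lambda>u. field_coeff' n (u + e))"
    by (rule continuous_on_compose2[OF continuous_on_field_coeff, of "{1..}" "\<lambda>u. u + e"]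
        continuous_on_compose2[OF continuous_on_field_coeff', of "{1..}" "\<lambda>u. u + e"],
        use assms in \<open>auto intro!: continuous_intros\<close>)+
  then show ?thesis
    unfolding regularized_weight_def[abs_def] by (intro continuous_intros)
qed

lemma regularized_weight_tendsto:
  assumes u: "u > 1" and e: "e \<longlonglongrightarrow> 0"
  shows "(\<lambda>i. regularized_weight n (e i) u) \<longlonglongrightarrow> weight n u"
proof -
  have "isCont (field_coeff' n) u" "isCont (field_coeff n) u"
    using continuous_on_field_coeff'[of n] u DERIV_isCont[OF DERIV_field_coeff[OF u]]
    by (auto simp: continuous_on_eq_continuous_at)
  moreover have "(\<lambda>i. u + e i) \<longlonglongrightarrow> u"
    using tendsto_add[OF tendsto_const[of u] e] by simp
  ultimately have "(\<lambda>i. field_coeff' n (u + e i)) \<longlonglongrightarrow> field_coeff' n u" "(\<lambda>i. field_coeff n (u + e i)) \<longlonglongrightarrow> field_coeff n u"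
    by (auto intro: isCont_tendsto_compose)
  then show ?thesis
    unfolding regularized_weight_def Riccati_field_coeff[OF u, symmetric]
    by (intro tendsto_intros)
qed

section \<open>The divergence theorem\<close>

lemma has_derivative_zero_off_support:
  fixes f :: "'a::real_normed_vector \<Rightarrow> 'b::real_normed_vector"
  assumes d: "(f has_derivative f') (at x)" and K: "closed K" "\<And>x. x \<notin> K \<Longrightarrow> f x = 0" and x: "x \<notin> K"
  shows "f' = (\<lambda>v. 0)"
proof -
  have "((\<lambda>x. 0) has_derivative f') (at x)"
    by (rule has_derivative_transform_within_open[OF d, of "- K"]) (use K x in auto)
  then show ?thesis
    using has_derivative_unique has_derivative_const by blast
qed

lemma integrable_continuous_compact_support:
  fixes f :: "'a::euclidean_space \<Rightarrow> real"
  assumes "continuous_on K f" "compact K" "\<And>x. x \<notin> K \<Longrightarrow> f x = 0"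
  shows "integrable lborel f"
proof -
  have "(\<lambda>x. indicator K x *\<^sub>R f x) = f"
    using assms(3) by (auto simp: fun_eq_iff indicator_def)
  then show ?thesis using borel_integrable_compact[OF assms(2,1)] by simp
qed

text \<open>Translation invariance makes the integral of every difference quotient zero. The
  quotients converge to the derivative, and dominated convergence passes to the limit.\<close>

lemma integral_directional_derivative_eq_0:
  fixes f :: "'a::euclidean_space \<Rightarrow> real"
  assumes d: "\<And>x. (f has_derivative f' x) (at x)" and c: "continuous_on UNIV (\<lambda>x. f' x v)"
    and K: "compact K" "\<And>x. x \<notin> K \<Longrightarrow> f x = 0"
  shows "(\<integral>x. f' x v \<partial>lborel) = 0"
proof -
  have g0: "f' x v = 0" if "x \<notin> K" for x
    using has_derivative_zero_off_support[OF d compact_imp_closed[OF K(1)] K(2) that] by simp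
  obtain B where B: "\<And>x. \<bar>f' x v\<bar> \<le> B" and "B \<ge> 0"
  proof -
    have "bounded ((\<lambda>x. f' x v) ` K)"
      by (intro compact_imp_bounded compact_continuous_image continuous_on_subset[OF c] K) auto
    then obtain B where "B > 0" "\<And>x. x \<in> K \<Longrightarrow> \<bar>f' x v\<bar> \<le> B"
      unfolding bounded_pos by auto
    then show ?thesis using g0 by (intro that[of B]) (metis abs_zero less_eq_real_def, simp)
  qed
  obtain R where R: "\<And>x. x \<in> K \<Longrightarrow> norm x \<le> R"
    using compact_imp_bounded[OF K(1)] unfolding bounded_iff by blast
  \<comment> \<open>Steps of size at most 1 keep the supports of all difference quotients inside the
    fixed ball of radius R + |v|. Together with the mean value bound \<open>B\<close> this supplies
    the dominating function.\<close>
  define t where "t i = inverse (real (Suc i))" for i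
  have t: "t i > 0" "t i \<le> 1" for i by (auto simp: t_def divide_simps)
  define h where "h i x = (f (x + t i *\<^sub>R v) - f x) / t i" for i x
  have line: "((\<lambda>s. f (x + s *\<^sub>R v)) has_real_derivative f' (x + s *\<^sub>R v) v) (at s)" for x s
  proof -
    have "((\<lambda>s. f (x + s *\<^sub>R v)) has_derivative (\<lambda>s'. f' (x + s *\<^sub>R v) (s' *\<^sub>R v))) (at s)"
      by (rule has_derivative_compose[OF _ d]) (auto intro!: derivative_eq_intros)
    moreover have "f' (x + s *\<^sub>R v) (s' *\<^sub>R v) = s' * f' (x + s *\<^sub>R v) v" for s'
      using linear_scale[OF has_derivative_linear[OF d]] by simp
    ultimately show ?thesis by (simp add: has_field_derivative_def mult.commute[of _ "f' _ v"])
  qed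
  have cf: "continuous_on UNIV f"
    using d has_derivative_continuous by (force simp: continuous_on_eq_continuous_within)
  have intf: "integrable lborel f"
    by (rule integrable_continuous_compact_support[OF continuous_on_subset[OF cf] K]) auto
  have mf[measurable]: "f \<in> borel_measurable borel" by (rule borel_measurable_continuous_onI[OF cf])
  have mg[measurable]: "(\<lambda>x. f' x v) \<in> borel_measurable borel" by (rule borel_measurable_continuous_onI[OF c])
  have shift: "integrable lborel (\<lambda>x. f (x + w))" "(\<integral>x. f (x + w) \<partial>lborel) = (\<integral>x. f x \<partial>lborel)" for w
  proof -
    have e: "integrable (distr lborel borel ((+) w)) f" "(\<integral>x. f x \<partial>distr lborel borel ((+) w)) = (\<integral>x. f x \<partial>lborel)"
      using intf by (simp_all add: lborel_distr_plus)
    then show "integrable lborel (\<lambda>x. f (x + w))" "(\<integral>x. f (x + w) \<partial>lborel) = (\<integral>x. f x \<partial>lborel)"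
      by (simp_all add: integrable_distr_eq integral_distr add.commute)
  qed
  have "(\<lambda>i. \<integral>x. h i x \<partial>lborel) \<longlonglongrightarrow> (\<integral>x. f' x v \<partial>lborel)"
  proof (rule integral_dominated_convergence[where w = "\<lambda>x. indicator (cball 0 (R + norm v)) x *\<^sub>R B"])
    show "integrable lborel (\<lambda>x. indicator (cball (0::'a) (R + norm v)) x *\<^sub>R B)"
      by (intro borel_integrable_compact) auto
    show "AE x in lborel. (\<lambda>i. h i x) \<longlonglongrightarrow> f' x v"
    proof (rule AE_I2)
      fix x
      have "((\<lambda>s. (f (x + s *\<^sub>R v) - f x) / s) \<longlongrightarrow> f' x v) (at 0)"
        using line[of x 0] by (simp add: has_field_derivative_iff)
      moreover have "filterlim t (at 0) sequentially"
        unfolding filterlim_at t_def using LIMSEQ_inverse_real_of_nat by auto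
      ultimately show "(\<lambda>i. h i x) \<longlonglongrightarrow> f' x v"
        unfolding h_def by (rule filterlim_compose)
    qed
    show "AE x in lborel. norm (h i x) \<le> indicator (cball 0 (R + norm v)) x *\<^sub>R B" for i
    proof (rule AE_I2)
      fix x
      obtain s where s: "f (x + t i *\<^sub>R v) - f (x + 0 *\<^sub>R v) = (t i - 0) * f' (x + s *\<^sub>R v) v"
        using MVT2[of 0 "t i" "\<lambda>s. f (x + s *\<^sub>R v)" "\<lambda>s. f' (x + s *\<^sub>R v) v"] line t(1) by blast
      then have 1: "\<bar>h i x\<bar> \<le> B" using t(1)[of i] B by (simp add: h_def)
      have "norm (t i *\<^sub>R v) \<le> norm v" using t[of i] by (simp add: mult_left_le_one_le)
      then have "h i x = 0" if "x \<notin> cball 0 (R + norm v)"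
        using that K(2)[of x] K(2)[of "x + t i *\<^sub>R v"] R[of x] R[of "x + t i *\<^sub>R v"]
          norm_triangle_ineq4[of "x + t i *\<^sub>R v" "t i *\<^sub>R v"] norm_ge_zero[of v]
        by (force simp: h_def)
      then show "norm (h i x) \<le> indicator (cball 0 (R + norm v)) x *\<^sub>R B"
        using 1 by (auto simp: indicator_def)
    qed
  qed (auto simp: h_def)
  moreover have "(\<integral>x. h i x \<partial>lborel) = 0" for i
    using shift[of "t i *\<^sub>R v"] intf by (simp add: h_def)
  ultimately show ?thesis by (simp add: LIMSEQ_const_iff)
qed

lemma divergence_theorem_compact_support:
  fixes X :: "'a::euclidean_space \<Rightarrow> 'a"
  assumes d: "\<And>x. (X has_derivative X' x) (at x)"
    and c: "\<And>b. b \<in> Basis \<Longrightarrow> continuous_on UNIV (\<lambda>x. X' x b)"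
    and K: "compact K" "\<And>x. x \<notin> K \<Longrightarrow> X x = 0"
  shows "(\<integral>x. (\<Sum>b\<in>Basis. X' x b \<bullet> b) \<partial>lborel) = 0"
proof -
  have i: "integrable lborel (\<lambda>x. X' x b \<bullet> b)" if "b \<in> Basis" for b
  proof (rule integrable_continuous_compact_support[OF _ K(1)])
    show "continuous_on K (\<lambda>x. X' x b \<bullet> b)"
      by (intro continuous_intros continuous_on_subset[OF c[OF that]]) auto
    show "X' x b \<bullet> b = 0" if "x \<notin> K" for x
      using has_derivative_zero_off_support[OF d compact_imp_closed[OF K(1)] K(2) that] by simp
  qed
  have z: "(\<integral>x. X' x b \<bullet> b \<partial>lborel) = 0" if b: "b \<in> Basis" for b
    by (rule integral_directional_derivative_eq_0[of "\<lambda>x. X x \<bullet> b" "\<lambda>x v. X' x v \<bullet> b", OF _ _ K(1)])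
       (auto intro!: has_derivative_inner_left d continuous_intros c[OF b] simp: K(2))
  show ?thesis
    by (subst Bochner_Integration.integral_sum) (use i z in auto)
qed

section \<open>The Riemannian measure\<close>

text \<open>Conjugation by an orthogonal matrix taking \<open>a\<close> to a multiple of a
  coordinate axis gives a diagonal matrix with a single entry that can differ from 1.\<close>

lemma det_rank_one_update:
  fixes a :: "real ^ 'm::finite"
  shows "det (\<chi> j k. (if j = k then 1 else 0) + c * (a $ j * a $ k)) = 1 + c * (norm a)\<^sup>2"
proof -
  obtain m :: 'm where True by blast
  have "norm a = norm (axis m (norm a))" by (simp add: norm_eq_sqrt_inner[of "axis _ _"] inner_axis_axis)
  then obtain f where f: "orthogonal_transformation f" "f a = axis m (norm a)"
    by (rule orthogonal_transformation_exists)
  define Q where "Q = matrix f"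
  have Q: "orthogonal_matrix Q" using f(1) by (simp add: Q_def orthogonal_transformation_matrix)
  have Qa: "Q *v a = axis m (norm a)"
    using f by (simp add: Q_def matrix_works orthogonal_transformation_linear linear_matrix_vector_mul_eq)
  define A where "A = (\<chi> j k. (if j = k then 1 else 0) + c * (a $ j * a $ k))"
  define E where "E = (\<chi> j k. (if j = k then 1 else 0 :: real) + c * (axis m (norm a) $ j * axis m (norm a) $ k))"
  have "Q ** A = E ** Q"
  proof -
    have QA: "(Q ** A) $ j $ k = Q $ j $ k + c * ((Q *v a) $ j * a $ k)" for j k
      by (simp add: A_def matrix_matrix_mult_def matrix_vector_mult_def distrib_left sum.distrib
          sum_distrib_left sum_distrib_right mult_ac if_distrib[of "\<lambda>x. _ * x"] cong: if_cong)
    have TQ: "transpose Q *v (Q *v a) = a"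
      using Q by (simp add: matrix_vector_mul_assoc orthogonal_matrix)
    have a: "a $ k = (\<Sum>i\<in>UNIV. Q $ i $ k * (Q *v a) $ i)" for k
      by (subst TQ[symmetric]) (simp add: matrix_vector_mult_def transpose_def)
    have EQ: "(E ** Q) $ j $ k = Q $ j $ k + c * ((Q *v a) $ j * a $ k)" for j k
      by (subst a) (simp add: E_def Qa[symmetric] matrix_matrix_mult_def distrib_left distrib_right sum.distrib
          sum_distrib_left sum_distrib_right mult_ac if_distrib[of "\<lambda>x. _ * x"] cong: if_cong)
    show ?thesis by (simp add: vec_eq_iff QA EQ)
  qed
  then have "det Q * det A = det E * det Q" by (metis det_mul)
  moreover have "det Q \<noteq> 0" using det_orthogonal_matrix[OF Q] by auto
  ultimately have "det A = det E" by simp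
  also have "det E = (\<Prod>i\<in>UNIV. E $ i $ i)"
    by (rule det_diagonal) (auto simp: E_def axis_def)
  also have "\<dots> = (\<Prod>i\<in>UNIV. if i = m then 1 + c * (norm a)\<^sup>2 else 1)"
    by (rule prod.cong) (auto simp: E_def axis_def power2_eq_square)
  finally show ?thesis by (simp add: A_def)
qed

text \<open>Once l is factored out of each row, the matrix is a product of two rank-one updates of
  the identity. Their cross term carries the factor \<open>a \<bullet> b\<close> and
  vanishes.\<close>

lemma det_rank_two_update:
  fixes a b :: "real ^ 'm::finite"
  assumes ab: "a \<bullet> b = 0" and l: "l \<noteq> 0"
  shows "det (\<chi> j k. l * (if j = k then 1 else 0) + c * (a $ j * a $ k + b $ j * b $ k))
    = l ^ CARD('m) * (1 + c / l * (norm a)\<^sup>2) * (1 + c / l * (norm b)\<^sup>2)"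
proof -
  define M where "M a = (\<chi> j k. (if j = k then 1 else 0) + c / l * (a $ j * a $ k))" for a :: "real ^ 'm"
  have "(M a ** M b) $ j $ k = (if j = k then 1 else 0) + c / l * (a $ j * a $ k + b $ j * b $ k)" for j k
  proof -
    have "(M a ** M b) $ j $ k = (\<Sum>i\<in>UNIV. ((if j = i then 1 else 0) + c / l * (a $ j * a $ i)) * ((if i = k then 1 else 0) + c / l * (b $ i * b $ k)))"
      by (simp add: M_def matrix_matrix_mult_def)
    also have "\<dots> = (\<Sum>i\<in>UNIV. (if j = i then (if i = k then 1 else 0) + c / l * (b $ i * b $ k) else 0)
        + (if i = k then c / l * (a $ j * a $ i) else 0) + (c / l)\<^sup>2 * (a $ j * b $ k) * (a $ i * b $ i))"
      by (rule sum.cong) (auto simp: algebra_simps power2_eq_square)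
    also have "\<dots> = (if j = k then 1 else 0) + c / l * (a $ j * a $ k + b $ j * b $ k) + (c / l)\<^sup>2 * (a $ j * b $ k) * (a \<bullet> b)"
      by (simp only: sum.distrib inner_vec_def flip: sum_distrib_left) (simp add: algebra_simps)
    finally show ?thesis by (simp add: ab)
  qed
  then have "(\<chi> j k. l * (if j = k then 1 else 0) + c * (a $ j * a $ k + b $ j * b $ k)) = (\<chi> j. l *s (M a ** M b) $ j)"
    using l by (simp add: vec_eq_iff algebra_simps)
  then have "det (\<chi> j k. l * (if j = k then 1 else 0) + c * (a $ j * a $ k + b $ j * b $ k)) = l ^ CARD('m) * det (M a ** M b)"
    using det_rows_mul[of "\<lambda>_. l" "\<lambda>j. (M a ** M b) $ j"] by simp
  then show ?thesis
    by (simp only: det_mul M_def det_rank_one_update mult.assoc)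
qed

section \<open>The Gram determinant of the Bergman metric\<close>

lemma inner_coord_frame: "v \<bullet> coord_frame (Inl i) = Re (v $ i)" "v \<bullet> coord_frame (Inr i) = Im (v $ i)"
  by (simp_all add: coord_frame_def inner_axis inner_complex_def)

lemma sum_coord_frame: "(\<Sum>k\<in>UNIV. (v \<bullet> coord_frame k) * (w \<bullet> coord_frame k)) = v \<bullet> w"
proof -
  have "(\<Sum>k\<in>UNIV. (v \<bullet> coord_frame k) * (w \<bullet> coord_frame k))
    = (\<Sum>k\<in>UNIV <+> UNIV. (v \<bullet> coord_frame k) * (w \<bullet> coord_frame k))" by simp
  also have "\<dots> = (\<Sum>i\<in>UNIV. Re (v $ i) * Re (w $ i)) + (\<Sum>i\<in>UNIV. Im (v $ i) * Im (w $ i))"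
    by (subst sum.Plus) (simp_all add: inner_coord_frame)
  also have "\<dots> = v \<bullet> w"
    by (simp add: inner_vec_def inner_complex_def sum.distrib)
  finally show ?thesis .
qed

lemma coord_frame_orthonormal: "coord_frame j \<bullet> coord_frame k = (if j = k then 1 else 0)"
  by (cases j; cases k) (auto simp: inner_coord_frame, auto simp: coord_frame_def axis_def)

definition CH_density :: "complex^'n::finite \<Rightarrow> real" where
  "CH_density z = (1 / (1 - (norm z)\<^sup>2)) ^ (CARD('n) + 1)"

text \<open>By \<open>CH_metric_alt\<close> the Gram matrix is 1 / D times the identity plus
  rank-one terms along the orthogonal vectors z and i z, with D = 1 - |z|^2. The identity part gives
  D^(-2n) and each of the two directions a further factor 1 / D.\<close>

lemma sqrt_det_gram_matrix:
  fixes z :: "complex^'n::finite"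
  assumes z: "z \<in> CH"
  shows "sqrt (det (gram_matrix CH_metric z)) = CH_density z"
proof -
  define D where "D = 1 - (norm z)\<^sup>2"
  have D: "D > 0" using CH_pos[OF z] by (simp add: D_def)
  define co where "co w = (\<chi> k. w \<bullet> coord_frame k)" for w :: "complex^'n"
  have co: "co v \<bullet> co w = v \<bullet> w" for v w
    using sum_coord_frame[of v w] by (simp add: co_def inner_vec_def)
  have nco: "(norm (co v))\<^sup>2 = (norm v)\<^sup>2" for v
    by (simp add: power2_norm_eq_inner co)
  have "z \<bullet> (\<i> *s z) = 0"
    by (simp add: herm_scale_right herm_self flip: Re_herm)
  then have o: "co z \<bullet> co (\<i> *s z) = 0" by (simp add: co)
  have "gram_matrix CH_metric z = (\<chi> j k. 1 / D * (if j = k then 1 else 0) + 1 / D\<^sup>2 * (co z $ j * co z $ k + co (\<i> *s z) $ j * co (\<i> *s z) $ k))"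
    unfolding gram_matrix_def CH_metric_alt coord_frame_orthonormal D_def[symmetric]
    by (simp add: vec_eq_iff co_def inner_commute)
  also have "det \<dots> = (1 / D) ^ CARD('n + 'n) * (1 + 1 / D\<^sup>2 / (1 / D) * (norm z)\<^sup>2) * (1 + 1 / D\<^sup>2 / (1 / D) * (norm z)\<^sup>2)"
    using D by (subst det_rank_two_update[OF o]) (simp_all add: nco norm_vector_scale)
  also have "1 + 1 / D\<^sup>2 / (1 / D) * (norm z)\<^sup>2 = 1 / D"
    using D by (simp add: divide_simps power2_eq_square) (simp add: D_def power2_eq_square algebra_simps)
  also have "(1 / D) ^ CARD('n + 'n) * (1 / D) * (1 / D) = ((1 / D) ^ (CARD('n) + 1))\<^sup>2"
    by (simp add: card_UNIV_sum power_add power2_eq_square mult_ac)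
  finally show ?thesis using D by (simp add: CH_density_def D_def[symmetric])
qed

lemma open_CH: "open CH" by (simp add: CH_def)

lemma CH_density_pos: "z \<in> CH \<Longrightarrow> CH_density z > 0"
  using CH_pos[of z] by (simp add: CH_density_def)

lemma continuous_on_CH_density: "continuous_on CH CH_density"
  unfolding CH_density_def by (intro continuous_intros) (use CH_pos in force)

lemma sets_CH[measurable]: "CH \<in> sets borel" by (simp add: open_CH)

lemma borel_measurable_on_CH: "continuous_on CH f \<Longrightarrow> f \<in> borel_measurable (restrict_space lborel CH)"
  for f :: "complex^'n::finite \<Rightarrow> 'b::topological_space"
  using borel_measurable_continuous_on_restrict[of CH f] 
  by (simp add: measurable_def space_restrict_space sets_restrict_space cong: measurable_cong_sets)

lemma riem_measure_CH:
  "riem_measure CH CH_metric = density (restrict_space lborel CH) (\<lambda>z. ennreal (CH_density z))"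
  unfolding riem_measure_def density_def
  by (rule measure_of_eq[OF sets.space_closed])
     (auto intro!: nn_integral_cong simp: sqrt_det_gram_matrix space_restrict_space)

lemma measurable_CH_density[measurable]: "CH_density \<in> borel_measurable (restrict_space lborel CH)"
  by (rule borel_measurable_on_CH[OF continuous_on_CH_density])

lemma nn_integral_riem_measure_CH:
  assumes [measurable]: "f \<in> borel_measurable (restrict_space lborel CH)" and "\<And>z. z \<in> CH \<Longrightarrow> f z \<ge> 0"
  shows "(\<integral>\<^sup>+z. ennreal (f z) \<partial>riem_measure CH CH_metric) = (\<integral>\<^sup>+z. ennreal (CH_density z * f z) \<partial>restrict_space lborel CH)"
  unfolding riem_measure_CH
  by (subst nn_integral_density)
     (auto intro!: nn_integral_cong simp: space_restrict_space assms(2) CH_density_pos less_imp_le ennreal_mult)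

text \<open>The field is extended by zero to the whole space. The extension is C^1 because it is so
  on \<open>U\<close> and on the complement of \<open>K\<close>, two open sets that cover the
  space.\<close>

lemma divergence_theorem_open:
  fixes X :: "'a::euclidean_space \<Rightarrow> 'a"
  assumes U: "open U" and K: "compact K" "K \<subseteq> U"
    and d: "\<And>x. x \<in> U \<Longrightarrow> (X has_derivative X' x) (at x)"
    and c: "\<And>b. b \<in> Basis \<Longrightarrow> continuous_on U (\<lambda>x. X' x b)"
    and z: "\<And>x. x \<in> U - K \<Longrightarrow> X x = 0"
  shows "(\<integral>x\<in>U. (\<Sum>b\<in>Basis. X' x b \<bullet> b) \<partial>lborel) = 0"
proof -
  define Y where "Y x = (if x \<in> U then X x else 0)" for x
  define Y' where "Y' x = (if x \<in> U then X' x else (\<lambda>v. 0))" for x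
  have oK: "open (- K)" using K by (simp add: compact_imp_closed open_Compl)
  have Y0: "Y x = 0" if "x \<notin> K" for x using z that by (auto simp: Y_def)
  have dY: "(Y has_derivative Y' x) (at x)" for x
  proof (cases "x \<in> U")
    case True
    then show ?thesis
      by (auto simp: Y'_def Y_def intro: has_derivative_transform_within_open[OF d U])
  next
    case False
    then have "x \<in> - K" using K by auto
    then have "(Y has_derivative (\<lambda>v. 0)) (at x)"
      by (rule has_derivative_transform_within_open[OF has_derivative_const oK]) (simp add: Y0)
    then show ?thesis using False by (simp add: Y'_def)
  qed
  have Y'0: "Y' x v = 0" if "x \<notin> K" for x v
    using has_derivative_zero_off_support[OF dY compact_imp_closed[OF K(1)] Y0 that] by simp
  have "continuous_on UNIV (\<lambda>x. Y' x b)" if b: "b \<in> Basis" for b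
  proof -
    have "continuous_on U (\<lambda>x. Y' x b)"
      by (rule continuous_on_eq[OF c[OF b]]) (simp add: Y'_def)
    moreover have "continuous_on (- K) (\<lambda>x. Y' x b)"
      by (rule continuous_on_eq[OF continuous_on_const[of _ 0]]) (simp add: Y'0)
    ultimately have "continuous_on (U \<union> - K) (\<lambda>x. Y' x b)"
      by (rule continuous_on_open_Un[OF U oK])
    moreover have "U \<union> - K = UNIV" using K by auto
    ultimately show ?thesis by simp
  qed
  from divergence_theorem_compact_support[OF dY this K(1) Y0]
  have "(\<integral>x. (\<Sum>b\<in>Basis. Y' x b \<bullet> b) \<partial>lborel) = 0" .
  moreover have "(\<Sum>b\<in>Basis. Y' x b \<bullet> b) = indicator U x *\<^sub>R (\<Sum>b\<in>Basis. X' x b \<bullet> b)" for x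
    by (simp add: Y'_def)
  ultimately show ?thesis by (simp add: set_lebesgue_integral_def)
qed

section \<open>Gradients and Laplacian\<close>

text \<open>The Euclidean gradient: it represents the differential by a vector, to which
  \<open>CH_raise\<close> can be applied.\<close>

definition diff_dual :: "('a::euclidean_space \<Rightarrow> real) \<Rightarrow> 'a \<Rightarrow> 'a" where
  "diff_dual f z = (\<Sum>b\<in>Basis. frechet_derivative f (at z) b *\<^sub>R b)"

lemma inner_diff_dual: "f differentiable (at z) \<Longrightarrow> v \<bullet> diff_dual f z = frechet_derivative f (at z) v"
proof -
  assume "f differentiable (at z)"
  then have l: "linear (frechet_derivative f (at z))" by (rule linear_frechet_derivative)
  have "frechet_derivative f (at z) v = frechet_derivative f (at z) (\<Sum>b\<in>Basis. (v \<bullet> b) *\<^sub>R b)"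
    by (simp add: euclidean_representation)
  also have "\<dots> = v \<bullet> diff_dual f z"
    by (simp add: diff_dual_def linear_sum[OF l] linear_scale[OF l] inner_sum_right mult.commute)
  finally show ?thesis ..
qed

text \<open>The inverse of the metric tensor, raising the index of the covector whose Euclidean
  representative is \<open>x\<close>. Being explicit, it shows that Riemannian gradients depend
  continuously on the point.\<close>

definition CH_raise :: "complex^'n::finite \<Rightarrow> complex^'n \<Rightarrow> complex^'n" where
  "CH_raise z x = (1 - (norm z)\<^sup>2) *\<^sub>R (x - herm x z *s z)"

lemma CH_metric_raise:
  assumes z: "z \<in> CH" shows "CH_metric z (CH_raise z x) v = v \<bullet> x"
proof -
  define D where "D = 1 - (norm z)\<^sup>2"
  have D: "D > 0" using CH_pos[OF z] by (simp add: D_def)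
  have s: "r *\<^sub>R w = complex_of_real r *s w" for r and w :: "complex^'n"
    by (simp add: vec_eq_iff) (simp add: scaleR_conv_of_real)
  have nz: "(norm z)\<^sup>2 = 1 - D" by (simp add: D_def)
  have 1: "herm (CH_raise z x) v = of_real D * (herm x v - herm x z * herm z v)"
    by (simp only: CH_raise_def s herm_scale_left herm_diff_left D_def)
  have "herm (CH_raise z x) z = of_real D * (herm x z - herm x z * of_real (1 - D))"
    by (simp only: CH_raise_def s herm_scale_left herm_diff_left herm_self nz) simp
  then have 2: "herm (CH_raise z x) z = of_real (D\<^sup>2) * herm x z"
    by (simp add: power2_eq_square algebra_simps)
  have "CH_metric z (CH_raise z x) v = Re (herm x v)"
    unfolding CH_metric_def 1 2 D_def[symmetric]
    using D by (simp add: mult.assoc del: of_real_power)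
  then show ?thesis by (simp add: Re_herm inner_commute)
qed

lemma riem_grad_CH:
  assumes z: "z \<in> CH" and f: "f differentiable (at z)"
  shows "riem_grad CH_metric f z = CH_raise z (diff_dual f z)"
  unfolding riem_grad_def
proof (rule the_equality)
  show "\<forall>v. CH_metric z (CH_raise z (diff_dual f z)) v = frechet_derivative f (at z) v"
    by (simp add: CH_metric_raise[OF z] inner_diff_dual[OF f])
next
  fix w assume w: "\<forall>v. CH_metric z w v = frechet_derivative f (at z) v"
  define x where "x = w + (- 1) *\<^sub>R CH_raise z (diff_dual f z)"
  have "CH_metric z x x = 0"
    unfolding x_def CH_metric_add_left[of z w] CH_metric_scaleR_left CH_metric_raise[OF z] inner_diff_dual[OF f]
    using w by simp
  then have "x = 0" using CH_metric_pos[OF z, of x] by auto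
  then show "w = CH_raise z (diff_dual f z)" by (simp add: x_def)
qed

definition CH_energy :: "(complex^'n::finite \<Rightarrow> real) \<Rightarrow> complex^'n \<Rightarrow> real" where
  "CH_energy f z = CH_metric z (riem_grad CH_metric f z) (riem_grad CH_metric f z)"

lemma CH_metric_riem_grad:
  assumes z: "z \<in> CH" and f: "f differentiable (at z)"
  shows "CH_metric z (riem_grad CH_metric f z) v = frechet_derivative f (at z) v"
  by (simp add: riem_grad_CH[OF assms] CH_metric_raise[OF z] inner_diff_dual[OF f])

lemma continuous_on_CH_energy:
  assumes "Ck_on (Suc 0) CH f" shows "continuous_on CH (CH_energy f)"
proof -
  have d: "\<And>z. z \<in> CH \<Longrightarrow> f differentiable (at z)"
    and c: "\<And>v. continuous_on CH (\<lambda>z. frechet_derivative f (at z) v)"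
    using assms by auto
  have x: "continuous_on CH (diff_dual f)"
    unfolding diff_dual_def by (intro continuous_intros c)
  have "continuous_on CH (\<lambda>z. CH_raise z (diff_dual f z))"
    unfolding CH_raise_def herm_def vector_scalar_mult_def
    by (intro continuous_intros x continuous_on_component) 
  then have "continuous_on CH (\<lambda>z. CH_raise z (diff_dual f z) \<bullet> diff_dual f z)"
    by (intro continuous_intros x)
  then show ?thesis
    by (rule continuous_on_eq) (simp add: CH_energy_def riem_grad_CH d CH_metric_raise)
qed

section \<open>The Laplacian of cosh^2 r\<close>

definition grad_cosh2' :: "complex^'n::finite \<Rightarrow> complex^'n \<Rightarrow> complex^'n \<Rightarrow> complex^'n" where
  "grad_cosh2' a z v = (- 2 * herm v a / (1 - (norm a)\<^sup>2)) *s (z - a) + (2 * (1 - herm z a) / (1 - (norm a)\<^sup>2)) *s v"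

lemma bounded_bilinear_vector_scale: "bounded_bilinear (\<lambda>(c::complex) (w::complex^'n::finite). c *s w)"
proof
  show "\<exists>K. \<forall>a b. norm ((a::complex) *s (b::complex^'n)) \<le> norm a * norm b * K"
    by (rule exI[of _ 1]) (simp add: norm_vector_scale)
qed (simp_all add: vec_eq_iff algebra_simps)

lemma has_derivative_grad_cosh2:
  "(grad_cosh2 a has_derivative grad_cosh2' a z) (at z)"
proof -
  have "((\<lambda>z. 2 * (1 - herm z a) / (1 - (norm a)\<^sup>2)) has_derivative (\<lambda>v. - 2 * herm v a / (1 - (norm a)\<^sup>2))) (at z)"
  proof -
    have "((\<lambda>z. 2 / (1 - (norm a)\<^sup>2) * (1 - herm z a)) has_derivative (\<lambda>v. 2 / (1 - (norm a)\<^sup>2) * (0 - herm v a))) (at z)"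
      by (intro has_derivative_mult_right has_derivative_diff has_derivative_const
          bounded_linear_imp_has_derivative bounded_linear_herm_left)
    then show ?thesis by simp
  qed
  moreover have "((\<lambda>z. z - a) has_derivative (\<lambda>v. v)) (at z)"
    by (auto intro!: derivative_eq_intros)
  ultimately show ?thesis
    unfolding grad_cosh2_def[abs_def]
    by (rule has_derivative_eq_rhs[OF bounded_bilinear.FDERIV[OF bounded_bilinear_vector_scale]])
       (simp add: grad_cosh2'_def fun_eq_iff add.commute)
qed

text \<open>The left-hand side is the real trace of the complex-linear map taking b to <b,a> w. Its
  complex trace is <w,a>, and a real trace is twice the real part of the complex one.\<close>

lemma sum_Basis_inner_herm:
  fixes a w :: "complex^'n::finite"
  shows "(\<Sum>b\<in>Basis. (herm b a *s w) \<bullet> b) = 2 * (a \<bullet> w)"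
proof -
  have "(\<Sum>b\<in>Basis. (herm b a *s w) \<bullet> b) = (\<Sum>b\<in>Basis. (w \<bullet> b) * (a \<bullet> b) + ((\<i> *s w) \<bullet> b) * ((\<i> *s a) \<bullet> b))"
  proof (rule sum.cong[OF refl])
    fix b :: "complex^'n"
    have "(herm b a *s w) \<bullet> b = Re (herm b a * herm w b)"
      by (simp only: herm_scale_left flip: Re_herm)
    also have "\<dots> = Re (herm w b * herm b a)" by (simp only: mult.commute)
    also have "\<dots> = (w \<bullet> b) * (a \<bullet> b) + (w \<bullet> (\<i> *s b)) * (a \<bullet> (\<i> *s b))" by (rule Re_herm_mult)
    \<comment> \<open>Moving i from b to the other argument changes the sign of both factors.
      Afterwards each product is summed by Parseval's identity for \<open>Basis\<close>.\<close>
    also have "\<dots> = (w \<bullet> b) * (a \<bullet> b) + ((\<i> *s w) \<bullet> b) * ((\<i> *s a) \<bullet> b)"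
      by (simp add: herm_scale_left herm_scale_right flip: Re_herm)
    finally show "(herm b a *s w) \<bullet> b = (w \<bullet> b) * (a \<bullet> b) + ((\<i> *s w) \<bullet> b) * ((\<i> *s a) \<bullet> b)" .
  qed
  also have "\<dots> = w \<bullet> a + (\<i> *s w) \<bullet> (\<i> *s a)"
    by (simp only: sum.distrib euclidean_inner[of w a] euclidean_inner[of "\<i> *s w" "\<i> *s a"])
  also have "(\<i> *s w) \<bullet> (\<i> *s a) = w \<bullet> a"
    by (simp add: herm_scale_left herm_scale_right flip: Re_herm)
  finally show ?thesis by (simp add: inner_commute)
qed

lemma sum_Basis_inner_scale: "(\<Sum>b\<in>Basis. (c *s b) \<bullet> (b :: complex^'n::finite)) = 2 * real CARD('n) * Re c"
proof -
  have "(\<Sum>b\<in>Basis. (c *s b) \<bullet> (b :: complex^'n)) = (\<Sum>b\<in>(Basis :: (complex^'n) set). Re c)"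
  proof (rule sum.cong[OF refl])
    fix b :: "complex^'n" assume b: "b \<in> Basis"
    have "(c *s b) \<bullet> b = Re (c * herm b b)" by (simp only: herm_scale_left flip: Re_herm)
    also have "\<dots> = Re c" using b by (simp add: herm_self)
    finally show "(c *s b) \<bullet> b = Re c" .
  qed
  then show ?thesis by (simp add: DIM_cart)
qed

text \<open>The left-hand side is the Laplacian of \<open>cosh\<^sup>2 r\<close>; its first term is the derivative of the
  logarithm of the Riemannian density along the gradient.\<close>

lemma divergence_grad_cosh2:
  fixes a z :: "complex^'n::finite"
  assumes a: "a \<in> CH" and z: "z \<in> CH"
  shows "2 * (real CARD('n) + 1) * (grad_cosh2 a z \<bullet> z) / (1 - (norm z)\<^sup>2) + (\<Sum>b\<in>Basis. grad_cosh2' a z b \<bullet> b)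
    = 4 * (real CARD('n) + 1) * cosh2_dist a z - 4"
proof -
  define D where "D = 1 - (norm z)\<^sup>2"
  define s where "s = 1 - (norm a)\<^sup>2"
  define b where "b = 1 - herm z a"
  define N where "N = (cmod b)\<^sup>2"
  define k where "k = 2 / s"
  define n where "n = real CARD('n)"
  have D: "D > 0" and s: "s > 0" using CH_pos a z by (auto simp: D_def s_def)
  have nz: "(norm z)\<^sup>2 = 1 - D" and na: "(norm a)\<^sup>2 = 1 - s" by (simp_all add: D_def s_def)
  have c: "herm a z = 1 - cnj b" by (simp add: b_def cnj_herm)
  have bb: "b * cnj b = of_real N" by (simp add: N_def complex_norm_square del: of_real_power)
  have G: "grad_cosh2 a z = (of_real k * b) *s (z - a)"
    by (simp add: grad_cosh2_def b_def s_def k_def)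
  have "herm (grad_cosh2 a z) z = of_real k * (b * (of_real (1 - D) - (1 - cnj b)))"
    by (simp only: G herm_scale_left herm_diff_left herm_self c nz mult.assoc)
  also have "\<dots> = of_real k * (of_real N - of_real D * b)"
    by (simp only: flip: bb) (simp add: algebra_simps)
  finally have 1: "grad_cosh2 a z \<bullet> z = k * (N - D * Re b)"
    by (simp flip: Re_herm)
  have G': "grad_cosh2' a z v = (- k) *\<^sub>R (herm v a *s (z - a)) + (of_real k * b) *s v" for v
    unfolding grad_cosh2'_def b_def s_def k_def
    by (simp add: vec_eq_iff) (simp add: scaleR_conv_of_real algebra_simps)
  have "(\<Sum>e\<in>Basis. grad_cosh2' a z e \<bullet> e) = - k * (\<Sum>e\<in>Basis. (herm e a *s (z - a)) \<bullet> e) + (\<Sum>e\<in>Basis. ((of_real k * b) *s e) \<bullet> (e :: complex^'n))"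
    by (simp only: G' inner_add_left inner_scaleR_left sum.distrib sum_distrib_left)
  also have "\<dots> = - k * (2 * (a \<bullet> (z - a))) + 2 * n * (k * Re b)"
    by (simp only: sum_Basis_inner_herm sum_Basis_inner_scale) (simp add: n_def)
  also have "a \<bullet> (z - a) = s - Re b"
    by (simp add: inner_diff_right b_def s_def Re_herm inner_commute power2_norm_eq_inner)
  finally have 2: "(\<Sum>e\<in>Basis. grad_cosh2' a z e \<bullet> e) = 2 * k * (Re b - s + n * Re b)"
    by (simp add: algebra_simps)
  have u: "cosh2_dist a z = N / (D * s)"
    by (simp add: cosh2_dist_def N_def b_def D_def s_def)
  show ?thesis
    unfolding 1 2 u D_def[symmetric] n_def[symmetric] k_def using D s
    by (simp add: divide_simps) (simp add: algebra_simps)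
qed

lemma has_derivative_CH_density:
  fixes z :: "complex^'n::finite"
  assumes z: "z \<in> CH"
  shows "(CH_density has_derivative (\<lambda>v. CH_density z * (2 * (real CARD('n) + 1) * (v \<bullet> z) / (1 - (norm z)\<^sup>2)))) (at z)"
proof -
  define D where "D = 1 - (norm z)\<^sup>2"
  have D: "D > 0" using CH_pos[OF z] by (simp add: D_def)
  have "((\<lambda>z. 1 - (norm z)\<^sup>2) has_derivative (\<lambda>v. - (2 * (v \<bullet> z)))) (at z)"
    by (auto intro!: derivative_eq_intros has_derivative_norm_sq simp: inner_commute)
  moreover have "((\<lambda>y. (1 / y) ^ (CARD('n) + 1)) has_real_derivative
      - ((real CARD('n) + 1) * (1 / D) ^ (CARD('n) + 1) / D)) (at D)"
    using D by (auto intro!: derivative_eq_intros simp: field_simps) (simp add: power_eq_if[of D "CARD('n)"])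
  ultimately have "(CH_density has_derivative (\<lambda>v. - (2 * (v \<bullet> z)) * - ((real CARD('n) + 1) * (1 / D) ^ (CARD('n) + 1) / D))) (at z)"
    unfolding CH_density_def[abs_def] D_def
    using has_derivative_compose[where g = "\<lambda>y. (1 / y) ^ (CARD('n) + 1)"]
    by (force simp: has_field_derivative_def mult.commute)
  then show ?thesis
    by (rule has_derivative_eq_rhs) (simp add: fun_eq_iff CH_density_def D_def[symmetric])
qed

section \<open>The regularized inequality\<close>

lemma integrable_on_CH:
  fixes f :: "complex^'n::finite \<Rightarrow> real"
  assumes c: "continuous_on CH f" and K: "compact K" "K \<subseteq> CH" "\<And>z. z \<in> CH - K \<Longrightarrow> f z = 0"
  shows "integrable (restrict_space lborel CH) f"
proof -
  have "integrable lborel (\<lambda>z. indicator CH z *\<^sub>R f z)"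
  proof (rule integrable_continuous_compact_support[OF _ K(1)])
    show "continuous_on K (\<lambda>z. indicator CH z *\<^sub>R f z)"
      by (rule continuous_on_eq[OF continuous_on_subset[OF c K(2)]]) (use K(2) in auto)
  qed (use K in \<open>auto simp: indicator_def\<close>)
  then show ?thesis by (subst integrable_restrict_space) auto
qed

text \<open>The trace of a rank-one map. It supplies the term dp(G) in the Euclidean divergence of p
  G.\<close>

lemma sum_Basis_rank_one: "linear l \<Longrightarrow> (\<Sum>b\<in>Basis. (l b *\<^sub>R w) \<bullet> b) = l w" for l :: "'a::euclidean_space \<Rightarrow> real"
proof -
  assume l: "linear l"
  have "l w = l (\<Sum>b\<in>Basis. (w \<bullet> b) *\<^sub>R b)" by (simp add: euclidean_representation)
  also have "\<dots> = (\<Sum>b\<in>Basis. (l b *\<^sub>R w) \<bullet> b)"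
    by (simp add: linear_sum[OF l] linear_scale[OF l] mult.commute)
  finally show ?thesis ..
qed

lemma continuous_on_cosh2_dist: "a \<in> CH \<Longrightarrow> continuous_on CH (cosh2_dist a)"
  by (auto intro!: continuous_at_imp_continuous_on has_derivative_continuous has_derivative_cosh2_dist)

lemma continuous_on_vector_scale:
  "continuous_on S f \<Longrightarrow> continuous_on S g \<Longrightarrow> continuous_on S (\<lambda>z. f z *s (g z :: complex^'n::finite))"
  by (rule bounded_bilinear.continuous_on[OF bounded_bilinear_vector_scale])

lemma continuous_on_herm: "continuous_on S f \<Longrightarrow> continuous_on S (\<lambda>z. herm (f z) w)"
  by (rule bounded_linear.continuous_on[OF bounded_linear_herm_left])

text \<open>The Euclidean divergence of density times field is the density times the Riemannian
  divergence, so the Euclidean divergence theorem is applied to the field weighted by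
  \<open>CH_density\<close>. Nonnegative integrals are the form required by Fatou's lemma;
  integrability of the energy is recorded because the local integrability of the weight will depend
  on it.\<close>

lemma regularized_poincare:
  fixes a :: "complex^'n::finite" and \<phi> :: "complex^'n \<Rightarrow> real"
  assumes a: "a \<in> CH" and e: "e > 0"
    and \<phi>: "Ck_on (Suc 0) CH \<phi>" and K: "compact (support_in CH \<phi>)"
  defines "n \<equiv> real CARD('n)"
  shows "(\<integral>\<^sup>+z. ennreal (CH_density z * (regularized_weight n e (cosh2_dist a z) * (\<phi> z)\<^sup>2)) \<partial>restrict_space lborel CH)
     \<le> (\<integral>\<^sup>+z. ennreal (CH_density z * CH_energy \<phi> z) \<partial>restrict_space lborel CH)" (is ?le)
    and "integrable (restrict_space lborel CH) (\<lambda>z. CH_density z * CH_energy \<phi> z)" (is ?int)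
proof -
  define K where "K = support_in CH \<phi>"
  have K: "compact K" "K \<subseteq> CH" and \<phi>0: "\<And>z. z \<in> CH - K \<Longrightarrow> \<phi> z = 0"
    using K closure_subset[of "{z \<in> CH. \<phi> z \<noteq> 0}"] unfolding K_def support_in_def by blast+
  have d\<phi>: "\<phi> differentiable (at z)" if "z \<in> CH" for z
    using \<phi> that by auto
  have cd\<phi>: "continuous_on CH (\<lambda>z. frechet_derivative \<phi> (at z) v)" for v
    using \<phi> by auto
  have D\<phi>: "(\<phi> has_derivative frechet_derivative \<phi> (at z)) (at z)" if "z \<in> CH" for z
    using d\<phi>[OF that] by (simp add: frechet_derivative_works)
  have c\<phi>: "continuous_on CH \<phi>"
    by (auto intro!: continuous_at_imp_continuous_on differentiable_imp_continuous_within d\<phi>)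
  have E0: "CH_energy \<phi> z = 0" if z: "z \<in> CH - K" for z
  proof -
    have "open (CH - K)" using open_CH K by (intro open_Diff compact_imp_closed)
    then have "(\<phi> has_derivative (\<lambda>v. 0)) (at z)"
      using \<phi>0 by (intro has_derivative_transform_within_open[OF has_derivative_const _ z]) auto
    then have "frechet_derivative \<phi> (at z) = (\<lambda>v. 0)" by (rule frechet_derivative_at[symmetric])
    then show ?thesis using z by (simp add: CH_energy_def CH_metric_riem_grad d\<phi>)
  qed
  define u where "u = cosh2_dist a"
  define F where "F z = field_coeff n (u z + e)" for z
  define F' where "F' z = field_coeff' n (u z + e)" for z
  define G where "G = grad_cosh2 a"
  have u: "u z \<ge> 1" "u z + e > 1" if "z \<in> CH" for z
    using cosh2_dist_ge_1(1)[OF a that] e by (simp_all add: u_def)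
  have cu: "continuous_on CH u" using continuous_on_cosh2_dist[OF a] by (simp add: u_def)
  have cF: "continuous_on CH F" unfolding F_def
    by (rule continuous_on_compose2[OF continuous_on_field_coeff, of CH "\<lambda>z. u z + e"])
       (use u(2) in \<open>auto intro!: continuous_intros cu\<close>)
  have cF': "continuous_on CH F'" unfolding F'_def
    by (rule continuous_on_compose2[OF continuous_on_field_coeff', of CH "\<lambda>z. u z + e"])
       (use u(2) in \<open>auto intro!: continuous_intros cu\<close>)
  have cG: "continuous_on CH G" unfolding G_def
    by (auto intro!: continuous_at_imp_continuous_on has_derivative_continuous has_derivative_grad_cosh2)
  have "complex_of_real (1 - (norm a)\<^sup>2) \<noteq> 0"
    using CH_pos[OF a] by (metis of_real_eq_0_iff less_irrefl)
  then have cG': "continuous_on CH (\<lambda>z. grad_cosh2' a z v)" for v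
    unfolding grad_cosh2'_def
    by (intro continuous_intros continuous_on_vector_scale continuous_on_herm) auto
  have cg: "continuous_on CH (\<lambda>z. CH_metric z (G z) v)" for v
    unfolding CH_metric_alt
    by (intro continuous_intros cG continuous_on_vector_scale) (use CH_pos in force)+
  have DF: "(F has_derivative (\<lambda>v. F' z * CH_metric z (G z) v)) (at z)" if z: "z \<in> CH" for z
  proof -
    have "((\<lambda>z. u z + e) has_derivative CH_metric z (G z)) (at z)"
      unfolding u_def G_def by (auto intro!: derivative_eq_intros has_derivative_cosh2_dist a z)
    moreover have "(field_coeff n has_derivative (\<lambda>h. F' z * h)) (at (u z + e))"
      using DERIV_field_coeff[OF u(2)[OF z]] by (simp add: has_field_derivative_def F'_def)
    ultimately show ?thesis
      unfolding F_def[abs_def] by (rule has_derivative_compose)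
  qed
  define dJ where "dJ z v = CH_density z * (2 * (n + 1) * (v \<bullet> z) / (1 - (norm z)\<^sup>2))" for z v :: "complex^'n"
  have DJ: "(CH_density has_derivative dJ z) (at z)" if "z \<in> CH" for z
    using has_derivative_CH_density[OF that] by (simp add: dJ_def[abs_def] n_def)
  have cdJ: "continuous_on CH (\<lambda>z. dJ z v)" for v
    unfolding dJ_def by (intro continuous_intros continuous_on_CH_density) (use CH_pos in force)
  define p where "p z = CH_density z * ((\<phi> z)\<^sup>2 * F z)" for z
  define dp where "dp z v = CH_density z * ((\<phi> z)\<^sup>2 * (F' z * CH_metric z (G z) v)
      + (2 * \<phi> z * frechet_derivative \<phi> (at z) v) * F z) + dJ z v * ((\<phi> z)\<^sup>2 * F z)" for z v
  have Dp: "(p has_derivative dp z) (at z)" if z: "z \<in> CH" for z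
  proof -
    have "((\<lambda>z. (\<phi> z)\<^sup>2) has_derivative (\<lambda>v. 2 * \<phi> z * frechet_derivative \<phi> (at z) v)) (at z)"
      using has_derivative_mult[OF D\<phi>[OF z] D\<phi>[OF z]] by (simp add: power2_eq_square algebra_simps)
    from has_derivative_mult[OF DJ[OF z] has_derivative_mult[OF this DF[OF z]]]
    show ?thesis unfolding p_def[abs_def] dp_def[abs_def] .
  qed
  have cp: "continuous_on CH p" unfolding p_def
    by (intro continuous_intros continuous_on_CH_density c\<phi> cF)
  have cdp: "continuous_on CH (\<lambda>z. dp z v)" for v unfolding dp_def
    by (intro continuous_intros continuous_on_CH_density c\<phi> cF cF' cg cd\<phi> cdJ)
  define X' where "X' z v = p z *\<^sub>R grad_cosh2' a z v + dp z v *\<^sub>R G z" for z v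
  define S where "S z = (\<Sum>b\<in>Basis. X' z b \<bullet> b)" for z
  have cX': "continuous_on CH (\<lambda>z. X' z b)" for b
    unfolding X'_def by (intro continuous_intros cp cG' cdp cG)
  have "(\<integral>z\<in>CH. S z \<partial>lborel) = 0"
    unfolding S_def
  proof (rule divergence_theorem_open[OF open_CH K, where X = "\<lambda>z. p z *\<^sub>R G z"])
    show "((\<lambda>z. p z *\<^sub>R G z) has_derivative X' z) (at z)" if "z \<in> CH" for z
      unfolding X'_def[abs_def] G_def
      by (rule has_derivative_scaleR[OF Dp[OF that] has_derivative_grad_cosh2])
  qed (use cX' \<phi>0 in \<open>auto simp: p_def\<close>)
  then have S0: "(\<integral>z. S z \<partial>restrict_space lborel CH) = 0"
    by (subst integral_restrict_space) (auto simp: set_lebesgue_integral_def)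
  \<comment> \<open>The product rule for div (\<phi>^2 F grad u): its terms contain the Laplacian of
    u, the derivative of \<phi> along grad u, and |grad u|^2.\<close>
  have S: "S z = CH_density z * ((4 * (n + 1) * u z - 4) * ((\<phi> z)\<^sup>2 * F z) + (2 * \<phi> z * F z) * frechet_derivative \<phi> (at z) (G z)
      + (\<phi> z)\<^sup>2 * F' z * (4 * u z * (u z - 1)))" if z: "z \<in> CH" for z
  proof -
    have l: "linear (dp z)" using Dp[OF z] by (rule has_derivative_linear)
    have "S z = p z * (\<Sum>b\<in>Basis. grad_cosh2' a z b \<bullet> b) + (\<Sum>b\<in>Basis. (dp z b *\<^sub>R G z) \<bullet> b)"
      by (simp only: S_def X'_def inner_add_left inner_scaleR_left sum.distrib sum_distrib_left)
    also have "(\<Sum>b\<in>Basis. (dp z b *\<^sub>R G z) \<bullet> b) = dp z (G z)" by (rule sum_Basis_rank_one[OF l])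
    also have "CH_metric z (G z) (G z) = 4 * u z * (u z - 1)"
      unfolding G_def u_def by (rule CH_metric_grad_cosh2[OF a z])
    then have "dp z (G z) = CH_density z * ((\<phi> z)\<^sup>2 * (F' z * (4 * u z * (u z - 1)))
      + (2 * \<phi> z * frechet_derivative \<phi> (at z) (G z)) * F z) + dJ z (G z) * ((\<phi> z)\<^sup>2 * F z)"
      by (simp add: dp_def)
    \<comment> \<open>The subtracted logarithmic derivative of the density is exactly what cancels
      \<open>dJ z (G z)\<close>.\<close>
    also have "(\<Sum>b\<in>Basis. grad_cosh2' a z b \<bullet> b) = 4 * (n + 1) * u z - 4 - 2 * (n + 1) * (G z \<bullet> z) / (1 - (norm z)\<^sup>2)"
      using divergence_grad_cosh2[OF a z] by (simp add: n_def u_def G_def)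
    finally show ?thesis by (simp add: p_def dJ_def algebra_simps)
  qed
  define A where "A z = CH_density z * (regularized_weight n e (u z) * (\<phi> z)\<^sup>2)" for z
  define B where "B z = CH_density z * CH_energy \<phi> z" for z
  \<comment> \<open>Young's inequality for grad \<phi> and \<phi> F grad u absorbs the cross term of
    \<open>S z\<close>. Since \<open>S\<close> integrates to zero, this pointwise bound gives the
    inequality.\<close>
  have le: "A z - B z \<le> S z" if z: "z \<in> CH" for z
  proof -
    define V where "V = riem_grad CH_metric \<phi> z"
    define W where "W = (\<phi> z * F z) *\<^sub>R G z"
    have "CH_metric z V W = \<phi> z * F z * frechet_derivative \<phi> (at z) (G z)"
      by (simp add: V_def W_def CH_metric_scaleR_right CH_metric_riem_grad[OF z d\<phi>[OF z]])
    moreover have "CH_metric z W W = (\<phi> z * F z)\<^sup>2 * (4 * u z * (u z - 1))"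
      unfolding u_def CH_metric_grad_cosh2[OF a z, symmetric]
      by (simp add: W_def CH_metric_scaleR_right CH_metric_scaleR_left G_def power2_eq_square)
    ultimately have "- 2 * (\<phi> z * F z * frechet_derivative \<phi> (at z) (G z)) \<le> CH_energy \<phi> z + (\<phi> z * F z)\<^sup>2 * (4 * u z * (u z - 1))"
      using CH_metric_Young[OF z, of V W] by (simp add: CH_energy_def V_def)
    then have "regularized_weight n e (u z) * (\<phi> z)\<^sup>2 - CH_energy \<phi> z \<le> (4 * (n + 1) * u z - 4) * ((\<phi> z)\<^sup>2 * F z) + (2 * \<phi> z * F z) * frechet_derivative \<phi> (at z) (G z)
      + (\<phi> z)\<^sup>2 * F' z * (4 * u z * (u z - 1))"
      unfolding regularized_weight_def F_def[symmetric] F'_def[symmetric]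
      by (simp add: power_mult_distrib algebra_simps)
    from mult_left_mono[OF this less_imp_le[OF CH_density_pos[OF z]]]
    show ?thesis by (simp only: S[OF z] A_def B_def right_diff_distrib)
  qed
  have cA: "continuous_on CH A"
    unfolding A_def regularized_weight_def F_def[symmetric] F'_def[symmetric]
    by (intro continuous_intros continuous_on_CH_density c\<phi> cF cF' cu)
  have iA: "integrable (restrict_space lborel CH) A"
    by (rule integrable_on_CH[OF cA K]) (simp add: A_def \<phi>0)
  have iB: "integrable (restrict_space lborel CH) B"
    by (rule integrable_on_CH[OF _ K])
       (auto simp: B_def[abs_def] E0 intro!: continuous_intros continuous_on_CH_density continuous_on_CH_energy \<phi>)
  have iS: "integrable (restrict_space lborel CH) S"
  proof (rule integrable_on_CH[OF _ K])
    show "continuous_on CH S" unfolding S_def by (intro continuous_intros cX')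
  qed (simp add: S \<phi>0)
  have "(\<integral>z. A z - B z \<partial>restrict_space lborel CH) \<le> (\<integral>z. S z \<partial>restrict_space lborel CH)"
    by (rule integral_mono) (use iA iB iS le in \<open>auto simp: space_restrict_space\<close>)
  then have "(\<integral>z. A z \<partial>restrict_space lborel CH) \<le> (\<integral>z. B z \<partial>restrict_space lborel CH)"
    using iA iB by (simp add: S0)
  moreover have "A z \<ge> 0" "B z \<ge> 0" if z: "z \<in> CH" for z
    unfolding A_def B_def using CH_density_pos[OF z] regularized_weight_nonneg[OF _ u(1)[OF z] e, of n] z
    by (auto simp: n_def CH_energy_def CH_metric_nonneg Suc_le_eq intro!: mult_nonneg_nonneg)
  ultimately show ?le
    unfolding A_def[symmetric, unfolded u_def] B_def[symmetric]
    using iA iB by (subst (1 2) nn_integral_eq_integral) (auto simp: space_restrict_space intro!: AE_I2 ennreal_leI)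
  show ?int using iB by (simp add: B_def[abs_def])
qed

section \<open>The distance function\<close>

text \<open>Along a curve r changes at most at the speed of the curve: Cauchy-Schwarz with |grad r|
  = 1. As r vanishes at the endpoint \<open>a\<close>, its initial value is at most the
  length.\<close>

lemma curve_length_ge:
  assumes a: "a \<in> CH" and \<gamma>: "valid_path \<gamma>" "path_image \<gamma> \<subseteq> CH" "pathfinish \<gamma> = a"
    and L: "curve_length_is CH_metric \<gamma> L"
  shows "dist_of (cosh2_dist a (pathstart \<gamma>)) \<le> L"
proof -
  have in_CH: "\<gamma> t \<in> CH" if "t \<in> {0..1}" for t
    using \<gamma>(2) that by (auto simp: path_image_def)
  have c\<gamma>: "continuous_on {0..1} \<gamma>"
    using \<gamma>(1) by (simp add: valid_path_def piecewise_C1_differentiable_on_def)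
  obtain S where S: "finite S" and "\<gamma> C1_differentiable_on ({0..1} - S)"
    using \<gamma>(1) unfolding valid_path_def piecewise_C1_differentiable_on_def by blast
  then obtain D where D: "\<And>t. t \<in> {0..1} - S \<Longrightarrow> (\<gamma> has_vector_derivative D t) (at t)"
    unfolding C1_differentiable_on_def by blast
  define u where "u t = cosh2_dist a (\<gamma> t)" for t
  define l where "l t = sqrt (CH_metric (\<gamma> t) (vector_derivative \<gamma> (at t)) (vector_derivative \<gamma> (at t)))" for t
  have l: "(l has_integral L) {0..1}"
    using L by (simp add: curve_length_is_def l_def[abs_def])
  have u1: "u t \<ge> 1" if "t \<in> {0..1}" for t
    using cosh2_dist_ge_1(1)[OF a in_CH[OF that]] by (simp add: u_def)
  have cu: "continuous_on {0..1} u"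
    unfolding u_def[abs_def]
    by (rule continuous_on_compose2[OF continuous_on_cosh2_dist[OF a] c\<gamma>]) (use in_CH in auto)
  \<comment> \<open>The curve may pass through \<open>a\<close> at any time, where u = 1 and the
    derivative formula for \<open>dist_of\<close> breaks down. The shift by \<open>e\<close> keeps
    the argument above 1 and is removed at the end by continuity.\<close>
  have le: "dist_of (u 0 + e) \<le> L + dist_of (1 + e)" if e: "e > 0" for e
  proof -
    define \<rho>' where "\<rho>' t = CH_metric (\<gamma> t) (grad_cosh2 a (\<gamma> t)) (D t) / (2 * sqrt ((u t + e) * (u t + e - 1)))" for t
    \<comment> \<open>The value 0 at the exceptional parameters makes the comparison with the speed
      hold there too, whatever \<open>vector_derivative\<close> returns; finitely many points do not
      affect the integral.\<close>
    define f where "f t = (if t \<in> S \<union> {0, 1} then 0 else \<rho>' t)" for t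
    have "(f has_integral (dist_of (u 1 + e) - dist_of (u 0 + e))) {0..1}"
    proof (rule fundamental_theorem_of_calculus_interior_strong[OF S])
      show "continuous_on {0..1} (\<lambda>t. dist_of (u t + e))"
        by (rule continuous_on_compose2[OF continuous_on_dist_of])
           (use u1 e in \<open>force intro!: continuous_intros cu\<close>)+
      fix t :: real assume t: "t \<in> {0<..<1} - S"
      then have t': "t \<in> {0..1}" "t \<in> {0..1} - S" by auto
      have "(u has_vector_derivative CH_metric (\<gamma> t) (grad_cosh2 a (\<gamma> t)) (D t)) (at t)"
        unfolding u_def[abs_def]
        using has_derivative_compose[OF D[OF t'(2), unfolded has_vector_derivative_def] has_derivative_cosh2_dist[OF a in_CH[OF t'(1)]]]
        by (simp add: has_vector_derivative_def CH_metric_scaleR_right mult.commute)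
      then have "((\<lambda>t. u t + e) has_real_derivative CH_metric (\<gamma> t) (grad_cosh2 a (\<gamma> t)) (D t)) (at t)"
        by (auto simp: has_real_derivative_iff_has_vector_derivative intro!: derivative_eq_intros)
      from DERIV_chain2[OF DERIV_dist_of this]
      show "((\<lambda>t. dist_of (u t + e)) has_vector_derivative f t) (at t)"
        using u1[OF t'(1)] e t by (simp add: f_def \<rho>'_def has_real_derivative_iff_has_vector_derivative)
    qed simp
    then have "((\<lambda>t. - f t) has_integral - (dist_of (u 1 + e) - dist_of (u 0 + e))) {0..1}"
      by (rule has_integral_neg)
    moreover have "- f t \<le> l t" if t: "t \<in> {0..1}" for t
    proof (cases "t \<in> S \<union> {0, 1}")
      case True
      then show ?thesis using CH_metric_nonneg[OF in_CH[OF t]] by (simp add: f_def l_def)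
    next
      case False
      then have vd: "vector_derivative \<gamma> (at t) = D t"
        using t by (intro vector_derivative_at D) auto
      define w where "w = (u t + e) * (u t + e - 1)"
      have "u t * (u t - 1) \<le> w" "w > 0"
        unfolding w_def using u1[OF t] e by (intro mult_mono mult_pos_pos; simp)+
      have "\<bar>CH_metric (\<gamma> t) (grad_cosh2 a (\<gamma> t)) (D t)\<bar> \<le> sqrt (4 * u t * (u t - 1)) * l t"
        unfolding u_def CH_metric_grad_cosh2[OF a in_CH[OF t], symmetric] l_def vd
        by (rule CH_metric_Cauchy_Schwarz[OF in_CH[OF t]])
      also have "\<dots> \<le> sqrt (4 * w) * l t"
        using \<open>u t * (u t - 1) \<le> w\<close> CH_metric_nonneg[OF in_CH[OF t]]
        by (intro mult_right_mono real_sqrt_le_mono) (auto simp: l_def)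
      also have "\<dots> = 2 * sqrt w * l t" by (simp add: real_sqrt_mult)
      finally have "\<bar>\<rho>' t\<bar> \<le> l t"
        using \<open>w > 0\<close> by (simp add: \<rho>'_def w_def[symmetric] divide_simps mult_ac)
      then show ?thesis using False by (simp add: f_def)
    qed
    ultimately have "- (dist_of (u 1 + e) - dist_of (u 0 + e)) \<le> L"
      by (rule has_integral_le[OF _ l])
    moreover have "u 1 = 1" using \<gamma>(3) cosh2_dist_self[OF a] by (simp add: u_def pathfinish_def)
    ultimately show ?thesis by simp
  qed
  define e where "e i = inverse (real (Suc i))" for i
  have e: "e \<longlonglongrightarrow> 0" "e i > 0" for i
    using LIMSEQ_inverse_real_of_nat by (auto simp: e_def[abs_def])
  have lim: "(\<lambda>i. dist_of (w + e i)) \<longlonglongrightarrow> dist_of w" if w: "w \<ge> 1" for w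
  proof (rule continuous_on_tendsto_compose[OF continuous_on_dist_of])
    show "(\<lambda>i. w + e i) \<longlonglongrightarrow> w" using tendsto_add[OF tendsto_const[of w] e(1)] by simp
    show "\<forall>\<^sub>F i in sequentially. w + e i \<in> {1..}"
      using w e(2) by (intro always_eventually) (simp add: add_increasing2 less_imp_le)
  qed (use w in auto)
  have "dist_of (u 0) \<le> L + dist_of 1"
    by (rule LIMSEQ_le[OF lim[OF u1] tendsto_add[OF tendsto_const lim]]) (use le[OF e(2)] in auto)
  then show ?thesis by (simp add: u_def pathstart_def dist_of_1)
qed

text \<open>The geodesic is the projection of the segment joining lifts of \<open>x\<close> and \<open>a\<close> to \<open>(n + 1)\<close>-space,
  with the lift of \<open>x\<close> scaled so that the Hermitian product of the two lifts is \<open>1\<close>. Its velocity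
  is a negative multiple of the gradient of \<open>cosh\<^sup>2 r\<close>.\<close>

lemma geodesic_exists:
  assumes a: "a \<in> CH" and x: "x \<in> CH" and ne: "x \<noteq> a"
  obtains \<gamma> where "valid_path \<gamma>" "path_image \<gamma> \<subseteq> CH" "pathstart \<gamma> = x" "pathfinish \<gamma> = a"
    "curve_length_is CH_metric \<gamma> (dist_of (cosh2_dist a x))"
proof -
  define s where "s = 1 - (norm a)\<^sup>2"
  define b where "b = 1 - herm x a"
  define \<mu> where "\<mu> = 1 / b"
  define lam where "lam w = (1 - w) * \<mu> + w" for w :: complex
  define k where "k w = (1 - w) * \<mu> / lam w" for w :: complex
  define \<gamma> where "\<gamma> t = a + k (of_real t) *s (x - a)" for t :: real
  define \<gamma>' where "\<gamma>' t = (- \<mu> / (lam (of_real t))\<^sup>2) *s (x - a)" for t :: real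
  have s: "s > 0" using CH_pos[OF a] by (simp add: s_def)
  have Rb: "Re b > 0" using one_minus_herm_nonzero[OF a x] by (simp add: b_def)
  then have b0: "b \<noteq> 0" by auto
  then have \<mu>0: "\<mu> \<noteq> 0" and \<mu>b: "\<mu> * b = 1" by (simp_all add: \<mu>_def)
  \<comment> \<open>With positive real part, \<mu> and 1 span a segment in the right half-plane, so
    the first coordinate \<open>lam\<close> of the lifted segment never vanishes and the projection
    is defined.\<close>
  have R\<mu>: "Re \<mu> > 0" using Rb by (simp add: \<mu>_def Re_divide add_pos_nonneg)
  have lam0: "lam (of_real t) \<noteq> 0" if t: "t \<in> {0..1}" for t
  proof -
    have "Re (lam (of_real t)) = (1 - t) * Re \<mu> + t" by (simp add: lam_def)
    also have "\<dots> > 0" using R\<mu> t by (cases "t = 1") (auto intro!: add_pos_nonneg)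
    finally show ?thesis by auto
  qed
  have "(k has_field_derivative - \<mu> / (lam w)\<^sup>2) (at w)" if "lam w \<noteq> 0" for w
    using that unfolding k_def[abs_def] lam_def[abs_def]
    by (auto intro!: derivative_eq_intros simp: power2_eq_square field_simps)
  then have D: "(\<gamma> has_vector_derivative \<gamma>' t) (at t)" if "t \<in> {0..1}" for t
  proof -
    have "((\<lambda>t. k (of_real t)) has_vector_derivative - \<mu> / (lam (of_real t))\<^sup>2) (at t)"
      by (rule has_vector_derivative_real_field) (use \<open>\<And>w. lam w \<noteq> 0 \<Longrightarrow> _\<close> lam0[OF that] in auto)
    from has_vector_derivative_add[OF has_vector_derivative_const[of a]
        bounded_linear.has_vector_derivative[OF bounded_linear_vector_scale[of "x - a"] this]]
    show ?thesis unfolding \<gamma>_def[abs_def] \<gamma>'_def by (simp only: add_0)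
  qed
  have c\<gamma>': "continuous_on {0..1} \<gamma>'"
    unfolding \<gamma>'_def[abs_def] using lam0
    by (intro continuous_on_vector_scale continuous_intros) (auto simp: lam_def intro!: continuous_intros)
  have vp: "valid_path \<gamma>"
    unfolding valid_path_def
    by (rule C1_differentiable_imp_piecewise) (use D c\<gamma>' in \<open>unfold C1_differentiable_on_def, blast\<close>)
  have ends: "\<gamma> 0 = x" "\<gamma> 1 = a" using \<mu>0 by (simp_all add: \<gamma>_def k_def lam_def)
  have in_CH: "\<gamma> t \<in> CH" if t: "t \<in> {0..1}" for t
  proof -
    define l where "l = lam (of_real t)"
    define P where "P = ((1 - of_real t) * \<mu>) *s x + of_real t *s a"
    have l0: "l \<noteq> 0" using lam0[OF t] by (simp add: l_def)
    have "l *s \<gamma> t = P"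
      using l0 unfolding \<gamma>_def k_def l_def[symmetric] P_def
      by (simp add: vec_eq_iff) (simp add: l_def lam_def algebra_simps)
    then have nP: "cmod l * norm (\<gamma> t) = norm P" by (metis norm_vector_scale)
    have 1: "(norm P)\<^sup>2 = (1 - t)\<^sup>2 * (cmod \<mu>)\<^sup>2 * (norm x)\<^sup>2 + 2 * t * (1 - t) * Re (\<mu> * herm x a) + t\<^sup>2 * (norm a)\<^sup>2"
    proof -
      have v: "of_real t *s a = t *\<^sub>R a" "((1 - of_real t) * \<mu>) *s x = (1 - t) *\<^sub>R (\<mu> *s x)"
        by (simp_all add: vec_eq_iff) (simp_all add: scaleR_conv_of_real)
      have "(\<mu> *s x) \<bullet> a = Re (\<mu> * herm x a)" by (simp only: herm_scale_left flip: Re_herm)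
      moreover have "(norm P)\<^sup>2 = (1 - t)\<^sup>2 * (norm (\<mu> *s x))\<^sup>2 + 2 * t * (1 - t) * ((\<mu> *s x) \<bullet> a) + t\<^sup>2 * (norm a)\<^sup>2"
        unfolding P_def v power2_norm_eq_inner
        by (simp only: inner_add_left inner_add_right inner_scaleR_left inner_scaleR_right inner_commute[of a "\<mu> *s x"])
           (simp add: power2_eq_square algebra_simps)
      ultimately show ?thesis
        by (simp add: norm_vector_scale power_mult_distrib)
    qed
    have 2: "(cmod l)\<^sup>2 = (1 - t)\<^sup>2 * (cmod \<mu>)\<^sup>2 + 2 * t * (1 - t) * Re \<mu> + t\<^sup>2"
      unfolding l_def lam_def cmod_power2 by (simp add: power2_eq_square algebra_simps)
    have 3: "Re (\<mu> * herm x a) = Re \<mu> - 1"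
      using arg_cong[OF \<mu>b, of Re] by (simp add: b_def algebra_simps)
    \<comment> \<open>The Hermitian form on the lifted segment; positivity means that the projected
      point lies in the ball. The scaling of the lift of x turns the mixed term into 2 t (1 - t), so
      all terms are nonnegative.\<close>
    have "(cmod l)\<^sup>2 - (norm P)\<^sup>2 = (1 - t)\<^sup>2 * (cmod \<mu>)\<^sup>2 * (1 - (norm x)\<^sup>2) + 2 * t * (1 - t) + t\<^sup>2 * s"
      unfolding 1 2 3 by (simp add: s_def algebra_simps)
    also have "\<dots> > 0"
    proof (cases "t = 0")
      case True
      then show ?thesis using \<mu>0 CH_pos[OF x] by simp
    next
      case False
      then show ?thesis using t s CH_pos[OF x] by (intro add_nonneg_pos) (auto intro!: add_nonneg_nonneg)
    qed
    finally have "(norm P)\<^sup>2 < (cmod l)\<^sup>2" by simp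
    then have "norm P < cmod l" by (rule power2_less_imp_less) simp
    then have "norm (\<gamma> t) < 1" using nP l0 by (metis mult.right_neutral mult_less_cancel_left_pos zero_less_norm_iff)
    then show ?thesis by (simp add: CH_iff_norm)
  qed
  define u where "u t = cosh2_dist a (\<gamma> t)" for t
  have u1: "u t \<ge> 1" if "t \<in> {0..1}" for t
    using cosh2_dist_ge_1(1)[OF a in_CH[OF that]] by (simp add: u_def)
  have c\<gamma>: "continuous_on {0..1} \<gamma>"
    using vp by (simp add: valid_path_def piecewise_C1_differentiable_on_def)
  have cu: "continuous_on {0..1} u"
    unfolding u_def[abs_def]
    by (rule continuous_on_compose2[OF continuous_on_cosh2_dist[OF a] c\<gamma>]) (use in_CH in auto)
  define l where "l t = sqrt (CH_metric (\<gamma> t) (vector_derivative \<gamma> (at t)) (vector_derivative \<gamma> (at t)))" for t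
  \<comment> \<open>The curve runs towards \<open>a\<close>, so r decreases at the rate of its
    speed.\<close>
  have "((\<lambda>t. - l t) has_integral (dist_of (u 1) - dist_of (u 0))) {0..1}"
  proof (rule fundamental_theorem_of_calculus_interior)
    show "continuous_on {0..1} (\<lambda>t. dist_of (u t))"
      by (rule continuous_on_compose2[OF continuous_on_dist_of cu]) (use u1 in auto)
    fix t :: real assume t: "t \<in> {0<..<1}"
    then have t': "t \<in> {0..1}" by auto
    note l0 = lam0[OF t']
    \<comment> \<open>\<open>m\<close> is the Hermitian product of the lifted point with the lift of
      a: the lift of x contributes (1 - t) times 1, the lift of a contributes t times s. The
      constant \<open>c\<close> is the factor between - grad u and the velocity.\<close>
    define m where "m = 1 - t + t * s"
    define c where "c = 2 * m * (1 - t) / s"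
    have c: "c > 0" using t s by (simp add: c_def m_def add_pos_pos)
    have "1 - complex_of_real t \<noteq> 0" using t by (simp add: complex_eq_iff)
    then have k0: "k (of_real t) \<noteq> 0" using \<mu>0 l0 by (simp add: k_def)
    have "1 - herm (\<gamma> t) a = of_real s * (1 - k (of_real t)) + k (of_real t) * b"
      by (simp only: \<gamma>_def herm_add_left herm_scale_left herm_diff_left herm_self)
         (simp add: s_def b_def algebra_simps)
    also have "1 - k (of_real t) = of_real t / lam (of_real t)"
      using l0 by (simp add: k_def field_simps) (simp add: lam_def algebra_simps)
    also have "k (of_real t) * b = (1 - of_real t) / lam (of_real t)"
      using \<mu>b by (simp add: k_def mult.assoc)
    finally have h: "1 - herm (\<gamma> t) a = of_real m / lam (of_real t)"
      by (simp add: m_def add_divide_distrib[symmetric] algebra_simps)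
    have "grad_cosh2 a (\<gamma> t) = (2 * (of_real m / lam (of_real t)) / of_real s * k (of_real t)) *s (x - a)"
      unfolding grad_cosh2_def h by (simp add: \<gamma>_def s_def)
    also have "2 * (of_real m / lam (of_real t)) / of_real s * k (of_real t) = of_real (- c) * (- \<mu> / (lam (of_real t))\<^sup>2)"
      by (simp add: k_def c_def power2_eq_square mult_ac)
    also have "\<dots> *s (x - a) = (- c) *\<^sub>R \<gamma>' t"
      unfolding \<gamma>'_def by (simp add: vec_eq_iff) (simp add: scaleR_conv_of_real right_diff_distrib mult.assoc)
    finally have G: "grad_cosh2 a (\<gamma> t) = (- c) *\<^sub>R \<gamma>' t" .
    define g where "g = CH_metric (\<gamma> t) (\<gamma>' t) (\<gamma>' t)"
    have lt: "l t = sqrt g" unfolding l_def g_def vector_derivative_at[OF D[OF t']] ..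
    have g: "4 * u t * (u t - 1) = c\<^sup>2 * g"
      unfolding u_def CH_metric_grad_cosh2[OF a in_CH[OF t'], symmetric] G
      by (simp only: CH_metric_scaleR_left CH_metric_scaleR_right g_def) (simp add: power2_eq_square)
    \<comment> \<open>The curve meets \<open>a\<close> only at t = 1, so \<open>dist_of\<close> is
      differentiable at \<open>u t\<close> for interior t without any regularization.\<close>
    have "\<gamma> t \<noteq> a" using k0 ne by (auto simp: \<gamma>_def)
    then have u: "u t > 1" using cosh2_dist_ge_1(2)[OF a in_CH[OF t']] by (simp add: u_def)
    then have "c\<^sup>2 * g > 0" unfolding g[symmetric] by simp
    then have g0: "g > 0" using c by (simp add: zero_less_mult_iff)
    have "sqrt (4 * (u t * (u t - 1))) = sqrt (c\<^sup>2 * g)" using g by (simp add: mult.assoc)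
    then have q: "2 * sqrt (u t * (u t - 1)) = c * sqrt g"
      using c by (simp add: real_sqrt_mult)
    have "(u has_vector_derivative CH_metric (\<gamma> t) (grad_cosh2 a (\<gamma> t)) (\<gamma>' t)) (at t)"
      unfolding u_def[abs_def]
      using has_derivative_compose[OF D[OF t', unfolded has_vector_derivative_def] has_derivative_cosh2_dist[OF a in_CH[OF t']]]
      by (simp add: has_vector_derivative_def CH_metric_scaleR_right mult.commute)
    then have "(u has_real_derivative - c * g) (at t)"
      unfolding G CH_metric_scaleR_left g_def by (simp add: has_real_derivative_iff_has_vector_derivative)
    from DERIV_chain2[OF DERIV_dist_of[OF u] this]
    have "((\<lambda>t. dist_of (u t)) has_real_derivative 1 / (c * sqrt g) * (- c * g)) (at t)"
      by (simp only: q)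
    moreover have "1 / (c * sqrt g) * (- c * g) = - sqrt g"
      using c g0 by (simp add: divide_simps)
    ultimately show "((\<lambda>t. dist_of (u t)) has_vector_derivative - l t) (at t)"
      by (simp add: lt has_real_derivative_iff_has_vector_derivative)
  qed simp
  from has_integral_neg[OF this] have "(l has_integral dist_of (cosh2_dist a x)) {0..1}"
    by (simp add: u_def ends cosh2_dist_self[OF a] dist_of_1)
  then have "curve_length_is CH_metric \<gamma> (dist_of (cosh2_dist a x))"
    by (simp add: curve_length_is_def l_def[abs_def])
  moreover have "path_image \<gamma> \<subseteq> CH" using in_CH by (auto simp: path_image_def)
  ultimately show ?thesis
    using that[OF vp] ends by (simp add: pathstart_def pathfinish_def)
qed

text \<open>The infimum is a minimum, attained by the explicit geodesic for distinct points and by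
  the constant path otherwise.\<close>

lemma riem_dist_CH:
  assumes a: "a \<in> CH" and x: "x \<in> CH"
  shows "riem_dist CH CH_metric x a = dist_of (cosh2_dist a x)"
  unfolding riem_dist_def
proof (rule cInf_eq_minimum)
  show "dist_of (cosh2_dist a x) \<in> {L. \<exists>\<gamma>. valid_path \<gamma> \<and> path_image \<gamma> \<subseteq> CH \<and> pathstart \<gamma> = x \<and> pathfinish \<gamma> = a
               \<and> curve_length_is CH_metric \<gamma> L}"
  proof (cases "x = a")
    case True
    have "curve_length_is CH_metric (\<lambda>_. a) 0"
      by (simp add: curve_length_is_def CH_metric_alt has_integral_0)
    then show ?thesis
      using a True by (auto simp: cosh2_dist_self dist_of_1 path_image_def pathstart_def pathfinish_def
          intro!: exI[of _ "\<lambda>_. a"] C1_differentiable_imp_piecewise simp: valid_path_def)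
  next
    case False
    then show ?thesis using geodesic_exists[OF a x] by blast
  qed
qed (use curve_length_ge[OF a] in auto)

section \<open>Passage to the limit\<close>

lemma Ck_on_imp_continuous_on: "Ck_on (Suc 0) X f \<Longrightarrow> continuous_on X f"
  by (auto intro!: continuous_at_imp_continuous_on differentiable_imp_continuous_within)

lemma weighted_poincare_nn_integral:
  fixes a :: "complex^'n::finite"
  assumes a: "a \<in> CH" and \<phi>: "Ck_on (Suc 0) CH \<phi>" and K: "compact (support_in CH \<phi>)"
  defines "n \<equiv> real CARD('n)"
  shows "(\<integral>\<^sup>+z. ennreal (CH_density z * (weight n (cosh2_dist a z) * (\<phi> z)\<^sup>2)) \<partial>restrict_space lborel CH)
     \<le> (\<integral>\<^sup>+z. ennreal (CH_density z * CH_energy \<phi> z) \<partial>restrict_space lborel CH)" (is "_ \<le> ?E")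
proof -
  define e where "e i = inverse (real (Suc i))" for i
  have e: "e \<longlonglongrightarrow> 0" "e i > 0" for i
    using LIMSEQ_inverse_real_of_nat by (auto simp: e_def[abs_def])
  define f where "f i z = ennreal (CH_density z * (regularized_weight n (e i) (cosh2_dist a z) * (\<phi> z)\<^sup>2))" for i z
  have meas: "f i \<in> borel_measurable (restrict_space lborel CH)" for i
  proof -
    have "continuous_on CH (\<lambda>z. regularized_weight n (e i) (cosh2_dist a z))"
      by (rule continuous_on_compose2[OF continuous_on_regularized_weight[OF e(2)] continuous_on_cosh2_dist[OF a]])
         (use cosh2_dist_ge_1(1)[OF a] in auto)
    then have "(\<lambda>z. CH_density z * (regularized_weight n (e i) (cosh2_dist a z) * (\<phi> z)\<^sup>2)) \<in> borel_measurable (restrict_space lborel CH)"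
      by (intro borel_measurable_on_CH continuous_intros continuous_on_CH_density Ck_on_imp_continuous_on[OF \<phi>])
    then show ?thesis unfolding f_def[abs_def] by measurable
  qed
  \<comment> \<open>The regularized weights are known to converge only where u > 1, that is, away
    from \<open>a\<close>; a single point is a null set.\<close>
  have "AE z in lborel. z \<noteq> a" by (rule AE_lborel_singleton)
  then have "AE z in restrict_space lborel CH. z \<noteq> a"
    by (subst AE_restrict_space_iff) auto
  then have "AE z in restrict_space lborel CH. ennreal (CH_density z * (weight n (cosh2_dist a z) * (\<phi> z)\<^sup>2)) = liminf (\<lambda>i. f i z)"
    using AE_space
  proof eventually_elim
    case (elim z)
    then have "cosh2_dist a z > 1" using cosh2_dist_ge_1(2)[OF a] by (simp add: space_restrict_space)
    then have "(\<lambda>i. f i z) \<longlonglongrightarrow> ennreal (CH_density z * (weight n (cosh2_dist a z) * (\<phi> z)\<^sup>2))"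
      unfolding f_def by (intro tendsto_ennrealI tendsto_intros regularized_weight_tendsto e)
    then show ?case by (simp add: lim_imp_Liminf)
  qed
  then have "(\<integral>\<^sup>+z. ennreal (CH_density z * (weight n (cosh2_dist a z) * (\<phi> z)\<^sup>2)) \<partial>restrict_space lborel CH)
    = (\<integral>\<^sup>+z. liminf (\<lambda>i. f i z) \<partial>restrict_space lborel CH)"
    by (rule nn_integral_cong_AE)
  also have "\<dots> \<le> liminf (\<lambda>i. \<integral>\<^sup>+z. f i z \<partial>restrict_space lborel CH)"
    by (rule nn_integral_liminf[OF meas])
  also have "\<dots> \<le> liminf (\<lambda>i. ?E)"
    unfolding f_def n_def
    by (intro Liminf_mono always_eventually allI regularized_poincare(1) a e \<phi> K)
  also have "\<dots> = ?E" by (simp add: Liminf_const)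
  finally show ?thesis .
qed

section \<open>C^1 cutoff functions for local integrability\<close>

lemma DERIV_max_0_squared: "((\<lambda>s. (max 0 s)\<^sup>2) has_real_derivative 2 * max 0 s) (at s)"
proof -
  consider "s < 0" | "s > 0" | "s = 0" by linarith
  then show ?thesis
  proof cases
    case 1
    have "((\<lambda>s. 0) has_real_derivative 0) (at s)" by simp
    then have "((\<lambda>s. (max 0 s)\<^sup>2) has_real_derivative 0) (at s)"
      by (rule has_field_derivative_transform_within_open[of _ _ _ "{..<0}"]) (use 1 in auto)
    then show ?thesis using 1 by simp
  next
    case 2
    have "((\<lambda>s. s\<^sup>2) has_real_derivative 2 * s) (at s)" by (auto intro!: derivative_eq_intros)
    then have "((\<lambda>s. (max 0 s)\<^sup>2) has_real_derivative 2 * s) (at s)"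
      by (rule has_field_derivative_transform_within_open[of _ _ _ "{0<..}"]) (use 2 in auto)
    then show ?thesis using 2 by simp
  next
    case 3
    have "((\<lambda>h::real. (max 0 h)\<^sup>2 / h) \<longlongrightarrow> 0) (at 0)"
      by (rule Lim_null_comparison[of _ "\<lambda>h. \<bar>h\<bar>"])
         (auto intro!: always_eventually tendsto_eq_intros simp: max_def power2_eq_square)
    then show ?thesis using 3 by (simp add: has_field_derivative_iff)
  qed
qed

lemma cutoff_exists:
  fixes K :: "(complex^'n::finite) set"
  assumes K: "compact K" "K \<subseteq> CH"
  obtains \<phi> :: "complex^'n \<Rightarrow> real" and c where "Ck_on (Suc 0) CH \<phi>" "compact (support_in CH \<phi>)" "c > 0" "\<And>z. z \<in> K \<Longrightarrow> c \<le> (\<phi> z)\<^sup>2"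
proof -
  obtain \<rho> where \<rho>: "0 \<le> \<rho>" "\<rho> < 1" "\<And>z. z \<in> K \<Longrightarrow> (norm z)\<^sup>2 \<le> \<rho>"
  proof (cases "K = {}")
    case True
    then show ?thesis using that[of 0] by simp
  next
    case False
    have "continuous_on K (\<lambda>z. (norm z)\<^sup>2)" by (intro continuous_intros)
    from continuous_attains_sup[OF K(1) False this]
    obtain w where "w \<in> K" "\<And>z. z \<in> K \<Longrightarrow> (norm z)\<^sup>2 \<le> (norm w)\<^sup>2" by auto
    then show ?thesis using that[of "(norm w)\<^sup>2"] K(2) CH_pos[of w] by auto
  qed
  \<comment> \<open>The midpoint of \<rho> and 1 leaves room on both sides: \<phi> is bounded below
    on \<open>K\<close>, and its support stays in a closed ball inside the unit ball.\<close>
  define \<sigma> where "\<sigma> = (1 + \<rho>) / 2"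
  have \<sigma>: "\<rho> < \<sigma>" "\<sigma> < 1" "\<sigma> > 0" using \<rho> by (simp_all add: \<sigma>_def)
  define \<phi> where "\<phi> z = (max 0 (\<sigma> - (norm z)\<^sup>2))\<^sup>2" for z :: "complex^'n"
  have D: "(\<phi> has_derivative (\<lambda>v. - (2 * (v \<bullet> z)) * (2 * max 0 (\<sigma> - (norm z)\<^sup>2)))) (at z)" for z
  proof -
    have "((\<lambda>z. \<sigma> - (norm z)\<^sup>2) has_derivative (\<lambda>v. - (2 * (v \<bullet> z)))) (at z)"
      by (auto intro!: derivative_eq_intros has_derivative_norm_sq simp: inner_commute)
    from has_derivative_compose[OF this DERIV_max_0_squared[unfolded has_field_derivative_def]]
    show ?thesis unfolding \<phi>_def[abs_def] by (simp add: mult.commute)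
  qed
  have "Ck_on (Suc 0) CH \<phi>"
  proof -
    have "frechet_derivative \<phi> (at z) = (\<lambda>v. - (2 * (v \<bullet> z)) * (2 * max 0 (\<sigma> - (norm z)\<^sup>2)))" for z
      using frechet_derivative_at[OF D] by simp
    then show ?thesis
      using D by (auto simp: differentiable_def intro!: continuous_intros)
  qed
  moreover have "compact (support_in CH \<phi>)"
  proof -
    have "{z \<in> CH. \<phi> z \<noteq> 0} \<subseteq> cball 0 (sqrt \<sigma>)"
      by (auto simp: \<phi>_def max_def real_le_rsqrt split: if_splits)
    then have cl: "closure {z \<in> CH. \<phi> z \<noteq> 0} \<subseteq> cball 0 (sqrt \<sigma>)"
      by (rule closure_minimal) simp
    moreover have "cball 0 (sqrt \<sigma>) \<subseteq> (CH :: (complex^'n) set)"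
      using \<sigma> by (simp add: CH_def cball_subset_ball_iff)
    ultimately have "support_in CH \<phi> = closure {z \<in> CH. \<phi> z \<noteq> 0}" by (auto simp: support_in_def)
    then show ?thesis using cl by (simp add: compact_eq_bounded_closed bounded_subset[OF bounded_cball])
  qed
  moreover have "((\<sigma> - \<rho>)\<^sup>2)\<^sup>2 \<le> (\<phi> z)\<^sup>2" if "z \<in> K" for z
    unfolding \<phi>_def using \<rho>(3)[OF that] \<sigma> by (intro power_mono) auto
  moreover have "((\<sigma> - \<rho>)\<^sup>2)\<^sup>2 > 0" using \<sigma> by simp
  ultimately show ?thesis using that by blast
qed

theorem lemma9:
  fixes x0 :: "complex ^ 'n::finite"
    and n :: real
    and r :: "complex ^ 'n \<Rightarrow> real"
  assumes "x0 \<in> CH"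
    and "n = real CARD('n)"
    and "r = (\<lambda>x. riem_dist CH CH_metric x x0)"
  shows "weighted_poincare CH CH_metric
           (\<lambda>x. n\<^sup>2 + 1 / 4 * (1 / (r x)\<^sup>2) + (n - 1)\<^sup>2 * (1 / (sinh (r x))\<^sup>2)
                  - 1 / (sinh (2 * r x))\<^sup>2)"
proof -
  define N :: "(complex^'n) measure" where "N = restrict_space lborel CH"
  define M :: "(complex^'n) measure" where "M = riem_measure CH CH_metric"
  define q where "q x = n\<^sup>2 + 1 / 4 * (1 / (r x)\<^sup>2) + (n - 1)\<^sup>2 * (1 / (sinh (r x))\<^sup>2) - 1 / (sinh (2 * r x))\<^sup>2" for x
  define u where "u = cosh2_dist x0"
  have u1: "u z \<ge> 1" if "z \<in> CH" for z using cosh2_dist_ge_1(1)[OF assms(1) that] by (simp add: u_def)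
  have q: "q z = weight n (u z)" if z: "z \<in> CH" for z
    unfolding q_def weight_def assms(3) riem_dist_CH[OF assms(1) z] u_def[symmetric]
    by (simp add: sinh_dist_of_sq sinh_double_dist_of_sq u1[OF z])
  \<comment> \<open>At x0 itself u = 1 and all quotients have denominator 0, hence value 0 in HOL;
    the weight there is n^2.\<close>
  have q0: "q z \<ge> 0" if z: "z \<in> CH" for z
    using weight_nonneg[of "u z" n] u1[OF z] by (cases "u z = 1") (simp_all add: q[OF z], simp add: weight_def dist_of_1)
  have MN: "borel_measurable M = (borel_measurable N :: (complex^'n \<Rightarrow> real) set)"
    unfolding M_def N_def riem_measure_CH by (rule measurable_cong_sets) simp_all
  have spM: "space M = CH" by (simp add: M_def riem_measure_CH space_restrict_space)
  have qN: "q \<in> borel_measurable N"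
  proof -
    have [measurable]: "u \<in> borel_measurable N"
      unfolding N_def u_def by (intro borel_measurable_on_CH continuous_on_cosh2_dist assms(1))
    have [measurable]: "(\<lambda>z. dist_of (u z)) \<in> borel_measurable N"
      unfolding N_def
      by (intro borel_measurable_on_CH continuous_on_compose2[OF continuous_on_dist_of])
         (use u1 in \<open>auto simp: u_def continuous_on_cosh2_dist assms(1)\<close>)
    have "(\<lambda>z. weight n (u z)) \<in> borel_measurable N" unfolding weight_def by measurable
    then show ?thesis
      by (subst measurable_cong) (auto simp: q N_def space_restrict_space)
  qed
  \<comment> \<open>Proved for all compactly supported C^1 functions, since it serves twice: with a
    cutoff to obtain local integrability, and with the smooth test functions of the theorem.\<close>
  have ineq: "(\<integral>\<^sup>+z. ennreal (q z * (\<phi> z)\<^sup>2) \<partial>M) \<le> (\<integral>\<^sup>+z. ennreal (CH_energy \<phi> z) \<partial>M)"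
    and fin: "(\<integral>\<^sup>+z. ennreal (CH_energy \<phi> z) \<partial>M) < \<infinity>"
    and mq: "(\<lambda>z. q z * (\<phi> z)\<^sup>2) \<in> borel_measurable M" and mE: "CH_energy \<phi> \<in> borel_measurable M"
    and E0: "\<And>z. z \<in> CH \<Longrightarrow> CH_energy \<phi> z \<ge> 0"
    if \<phi>: "Ck_on (Suc 0) CH \<phi>" and K: "compact (support_in CH \<phi>)" for \<phi> :: "complex^'n \<Rightarrow> real"
  proof -
    have [measurable]: "\<phi> \<in> borel_measurable N"
      unfolding N_def by (intro borel_measurable_on_CH Ck_on_imp_continuous_on[OF \<phi>])
    note qN[measurable]
    have mq': "(\<lambda>z. q z * (\<phi> z)\<^sup>2) \<in> borel_measurable N" by measurable
    have mE': "CH_energy \<phi> \<in> borel_measurable N"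
      unfolding N_def by (intro borel_measurable_on_CH continuous_on_CH_energy \<phi>)
    show E0: "\<And>z. z \<in> CH \<Longrightarrow> CH_energy \<phi> z \<ge> 0" by (simp add: CH_energy_def CH_metric_nonneg)
    show "(\<lambda>z. q z * (\<phi> z)\<^sup>2) \<in> borel_measurable M" "CH_energy \<phi> \<in> borel_measurable M"
      using mq' mE' by (simp_all add: MN)
    have Ee: "(\<integral>\<^sup>+z. ennreal (CH_energy \<phi> z) \<partial>M) = (\<integral>\<^sup>+z. ennreal (CH_density z * CH_energy \<phi> z) \<partial>N)"
      unfolding M_def N_def by (rule nn_integral_riem_measure_CH[OF mE'[unfolded N_def] E0])
    have "(\<integral>\<^sup>+z. ennreal (q z * (\<phi> z)\<^sup>2) \<partial>M) = (\<integral>\<^sup>+z. ennreal (CH_density z * (q z * (\<phi> z)\<^sup>2)) \<partial>N)"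
      unfolding M_def N_def by (rule nn_integral_riem_measure_CH[OF mq'[unfolded N_def]]) (simp add: q0)
    also have "\<dots> = (\<integral>\<^sup>+z. ennreal (CH_density z * (weight n (u z) * (\<phi> z)\<^sup>2)) \<partial>N)"
      by (rule nn_integral_cong) (simp add: q N_def space_restrict_space)
    also have "\<dots> \<le> (\<integral>\<^sup>+z. ennreal (CH_density z * CH_energy \<phi> z) \<partial>N)"
      unfolding N_def u_def assms(2) by (rule weighted_poincare_nn_integral[OF assms(1) \<phi> K])
    finally show "(\<integral>\<^sup>+z. ennreal (q z * (\<phi> z)\<^sup>2) \<partial>M) \<le> (\<integral>\<^sup>+z. ennreal (CH_energy \<phi> z) \<partial>M)"
      unfolding Ee .
    \<comment> \<open>Any positive regularization parameter yields this finiteness of the energy; 1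
      is taken.\<close>
    have "integrable N (\<lambda>z. CH_density z * CH_energy \<phi> z)"
      unfolding N_def by (rule regularized_poincare(2)[OF assms(1) zero_less_one \<phi> K])
    then show "(\<integral>\<^sup>+z. ennreal (CH_energy \<phi> z) \<partial>M) < \<infinity>"
      unfolding Ee
      by (subst nn_integral_eq_integral) (auto simp: N_def space_restrict_space E0 CH_density_pos less_imp_le intro!: AE_I2 mult_nonneg_nonneg)
  qed
  have "locally_L1 CH M q"
    unfolding locally_L1_def
  proof (intro allI impI)
    fix K :: "(complex^'n) set" assume K: "compact K \<and> K \<subseteq> CH"
    then obtain \<phi> c where \<phi>: "Ck_on (Suc 0) CH \<phi>" "compact (support_in CH \<phi>)" and c: "c > 0" "\<And>z. z \<in> K \<Longrightarrow> c \<le> (\<phi> z)\<^sup>2"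
      using cutoff_exists[of K] by blast
    have "K \<in> sets lborel" using K by (simp add: borel_compact)
    then have "K \<in> sets N" using K by (auto simp: N_def sets_restrict_space_iff)
    then have "(\<lambda>z. indicator K z *\<^sub>R q z) \<in> borel_measurable N" using qN by measurable
    then have m: "(\<lambda>z. indicator K z *\<^sub>R q z) \<in> borel_measurable M" by (simp add: MN)
    have "(\<integral>\<^sup>+z. ennreal (norm (indicator K z *\<^sub>R q z)) \<partial>M) \<le> (\<integral>\<^sup>+z. ennreal (1 / c) * ennreal (q z * (\<phi> z)\<^sup>2) \<partial>M)"
    proof (rule nn_integral_mono)
      fix z assume "z \<in> space M"
      then have z: "z \<in> CH" by (simp add: spM)
      have "norm (indicator K z *\<^sub>R q z) \<le> 1 / c * (q z * (\<phi> z)\<^sup>2)"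
      proof (cases "z \<in> K")
        case True
        have "q z * c \<le> q z * (\<phi> z)\<^sup>2" by (intro mult_left_mono c True q0 z)
        then show ?thesis using True c(1) q0[OF z] by (simp add: field_simps)
      next
        case False
        then show ?thesis using c(1) q0[OF z] by simp
      qed
      then show "ennreal (norm (indicator K z *\<^sub>R q z)) \<le> ennreal (1 / c) * ennreal (q z * (\<phi> z)\<^sup>2)"
        using c(1) q0[OF z] by (simp add: ennreal_leI flip: ennreal_mult)
    qed
    also have "\<dots> = ennreal (1 / c) * (\<integral>\<^sup>+z. ennreal (q z * (\<phi> z)\<^sup>2) \<partial>M)"
      by (rule nn_integral_cmult[OF measurable_compose[OF mq[OF \<phi>] measurable_ennreal]])
    also have "\<dots> < \<infinity>"
      using le_less_trans[OF ineq[OF \<phi>] fin[OF \<phi>]] by (simp add: ennreal_mult_less_top)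
    finally show "set_integrable M K q"
      unfolding set_integrable_def by (rule integrableI_bounded[OF m])
  qed
  moreover have "(\<integral>z. q z * (\<phi> z)\<^sup>2 \<partial>M) \<le> (\<integral>z. CH_energy \<phi> z \<partial>M)"
    if "smooth_on CH \<phi>" and K: "compact (support_in CH \<phi>)" for \<phi>
  proof -
    have \<phi>: "Ck_on (Suc 0) CH \<phi>" using that(1) unfolding smooth_on_def by blast
    note h = ineq[OF \<phi> K] fin[OF \<phi> K] mq[OF \<phi> K] mE[OF \<phi> K] E0[OF \<phi> K]
    have "(\<integral>z. q z * (\<phi> z)\<^sup>2 \<partial>M) = enn2real (\<integral>\<^sup>+z. ennreal (q z * (\<phi> z)\<^sup>2) \<partial>M)"
      by (rule integral_eq_nn_integral[OF h(3)]) (auto simp: spM q0)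
    \<comment> \<open>Finiteness of the energy is essential here, because \<open>enn2real\<close>
      sends infinity to 0 and is monotone only below it.\<close>
    also have "\<dots> \<le> enn2real (\<integral>\<^sup>+z. ennreal (CH_energy \<phi> z) \<partial>M)"
      using h(1,2) by (intro enn2real_mono) auto
    also have "\<dots> = (\<integral>z. CH_energy \<phi> z \<partial>M)"
      by (rule integral_eq_nn_integral[OF h(4), symmetric]) (auto simp: spM h(5))
    finally show ?thesis .
  qed
  ultimately show ?thesis
    unfolding weighted_poincare_def M_def CH_energy_def q_def[abs_def] by blast
qed

end
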